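(* Let $C\in\mathcal{C}_d$ be a closed convex cone. For each $\lambda\ge0$, the intrinsic volume random variable $V_C$ satisfies the upper tail bound $$\mathbb{P}\{V_C-\delta(C)\ge\lambda\}\le\exp\left(-\frac12\max\left\{\delta(C)\cdot\psi\left(\frac{\lambda}{\delta(C)}\right),\ \delta(C^\circ)\cdot\psi\left(\frac{-\lambda}{\delta(C^\circ)}\right)\right\}\right)$$ and the lower tail bound $$\mathbb{P}\{V_C-\delta(C)\le-\lambda\}\le\exp\left(-\frac12\max\left\{\delta(C)\cdot\psi\left(\frac{-\lambda}{\delta(C)}\right),\ \delta(C^\circ)\cdot\psi\left(\frac{\lambda}{\delta(C^\circ)}\right)\right\}\right).$$ The function $\psi(u):=(1+u)\log(1+u)-u$ for $u\ge-1$, while $\psi(u)=\infty$ for $u<-1$.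
   Context: $\mathbb{R}^d$ carries the standard inner product $\langle\cdot,\cdot\rangle$ and Euclidean norm $\|\cdot\|$. Cones. A convex cone $C\subset\mathbb{R}^d$ is a nonempty set with $\tau(x+y)\in C$ for all $\tau>0$, $x,y\in C$; $\mathcal{C}_d$ is the set of closed convex cones in $\mathbb{R}^d$. The polar cone is $C^\circ=\{u\in\mathbb{R}^d:\langle u,x\rangle\le 0 \text{ for all } x\in C\}\in\mathcal{C}_d$. The metric projector onto $C$ is $\Pi_C(x)=\arg\min\{\|x-y\|^2:y\in C\}$. A cone is polyhedral if it is a finite intersection of halfspaces $\{x:\langle u_i,x\rangle\ge0\}$. A face of a polyhedral cone $C$ is a set of the form $\{x\in C:\langle u,x\rangle=\sup_{y\in C}\langle u,y\rangle\}$ with $u\in C^\circ$; its dimension is the dimension of its linear hull, and its relative interior is its interior relative to its linear hull. Conic Hausdorff metric. For nonzero $x,y$ put $\mathrm{dist}_s(x,y)=\arccos\big(\langle x,y\rangle/(\|x\|\|y\|)\big)$, with $\mathrm{dist}_s(0,0)=0$ and $\mathrm{dist}_s(x,0)=\mathrm{dist}_s(0,x)=\pi/2$ for $x\ne0$. Put $\mathcal{T}_s(C,\alpha)=\{x\in\mathbb{R}^d:\mathrm{dist}_s(x,y)\le\alpha\text{ for some }y\in C\}$. The conic Hausdorff metric on $\mathcal{C}_d$ is $\mathrm{dist}_{\mathcal H}(C_1,C_2)=\inf\{\alpha\ge0:\mathcal{T}_s(C_1,\alpha)\supset C_2\text{ and }\mathcal{T}_s(C_2,\alpha)\supset C_1\}$.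 Conic intrinsic volumes. For polyhedral $C\in\mathcal{C}_d$ and $k=0,\dots,d$, $v_k(C)=\mathbb{P}\{\Pi_C(g)\text{ lies in the relative interior of a }k\text{-dimensional face of }C\}$, with $g$ a standard Gaussian vector in $\mathbb{R}^d$. For general $C\in\mathcal{C}_d$, $v_k(C)=\lim_{i\to\infty}v_k(C_i)$ for any sequence of polyhedral cones $C_i\in\mathcal{C}_d$ with $C_i\to C$ in the conic Hausdorff metric (polyhedral cones are dense, and the limit exists and does not depend on the sequence). The numbers $v_0(C),\dots,v_d(C)$ are nonnegative and sum to one. The intrinsic volume random variable $V_C$ has distribution $\mathbb{P}\{V_C=k\}=v_k(C)$ for $k=0,1,\dots,d$. The statistical dimension is $\delta(C):=\mathbb{E}[V_C]=\sum_{k=0}^d k\,v_k(C)$. *)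

theory Defs
  imports "HOL-Probability.Probability"
begin

definition closed_convex_cone :: "'a::euclidean_space set \<Rightarrow> bool" where
  "closed_convex_cone C \<longleftrightarrow> closed C \<and> convex_cone C"

text \<open>The library's \<open>convex_cone\<close> requires closure under scaling by 0 as well.
  For closed sets this agrees with asking only for positive scalars.\<close>

lemma closed_convex_cone_iff:
  fixes C :: "'a::euclidean_space set"
  shows "closed_convex_cone C \<longleftrightarrow>
    closed C \<and> C \<noteq> {} \<and> (\<forall>\<tau>>0. \<forall>x\<in>C. \<forall>y\<in>C. \<tau> *\<^sub>R (x + y) \<in> C)"
proof
  assume "closed_convex_cone C"
  then show "closed C \<and> C \<noteq> {} \<and> (\<forall>\<tau>>0. \<forall>x\<in>C. \<forall>y\<in>C. \<tau> *\<^sub>R (x + y) \<in> C)"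
    by (auto simp: closed_convex_cone_def intro!: convex_cone_scaleR convex_cone_add
             dest: convex_cone_nonempty)
next
  assume R: "closed C \<and> C \<noteq> {} \<and> (\<forall>\<tau>>0. \<forall>x\<in>C. \<forall>y\<in>C. \<tau> *\<^sub>R (x + y) \<in> C)"
  have add: "x + y \<in> C" if "x \<in> C" "y \<in> C" for x y
  proof -
    have "1 *\<^sub>R (x + y) \<in> C" using R that zero_less_one by blast
    then show ?thesis by simp
  qed
  have pos: "t *\<^sub>R x \<in> C" if "x \<in> C" "t > 0" for x and t :: real
  proof -
    have "(t / 2) *\<^sub>R (x + x) \<in> C" using R that half_gt_zero by blast
    then show ?thesis by (simp flip: scaleR_2)
  qed
  have zero: "0 \<in> C"
  proof -
    obtain x where x: "x \<in> C" using R by blast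
    have "(\<lambda>n. inverse (real (Suc n)) *\<^sub>R x) \<longlonglongrightarrow> 0 *\<^sub>R x"
      by (intro tendsto_intros LIMSEQ_inverse_real_of_nat)
    moreover have "inverse (real (Suc n)) *\<^sub>R x \<in> C" for n
      using pos[OF x, of "inverse (real (Suc n))"] by simp
    ultimately show ?thesis
      using R closed_sequentially[of C "\<lambda>n. inverse (real (Suc n)) *\<^sub>R x"] by simp
  qed
  have "convex_cone C"
    unfolding convex_cone_iff
  proof (intro conjI ballI allI impI)
    show "c *\<^sub>R x \<in> C" if "x \<in> C" "0 \<le> c" for x c
      using pos[of x c] that zero by (cases "c = 0") auto
  qed (use add zero in auto)
  then show "closed_convex_cone C"
    using R by (simp add: closed_convex_cone_def)
qed

definition polar_cone :: "'a::euclidean_space set \<Rightarrow> 'a set" where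
  "polar_cone C = {u. \<forall>x\<in>C. u \<bullet> x \<le> 0}"

definition polyhedral_cone :: "'a::euclidean_space set \<Rightarrow> bool" where
  "polyhedral_cone C \<longleftrightarrow> (\<exists>U. finite U \<and> C = {x. \<forall>u\<in>U. 0 \<le> u \<bullet> x})"

definition cone_faces :: "'a::euclidean_space set \<Rightarrow> 'a set set" where
  "cone_faces C = {{x \<in> C. u \<bullet> x = (SUP y\<in>C. u \<bullet> y)} | u. u \<in> polar_cone C}"

definition dist_s :: "'a::euclidean_space \<Rightarrow> 'a \<Rightarrow> real" where
  "dist_s x y =
    (if x = 0 \<and> y = 0 then 0
     else if x = 0 \<or> y = 0 then pi / 2
     else arccos (x \<bullet> y / (norm x * norm y)))"

definition angular_expansion :: "'a::euclidean_space set \<Rightarrow> real \<Rightarrow> 'a set" where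
  "angular_expansion C \<alpha> = {x. \<exists>y\<in>C. dist_s x y \<le> \<alpha>}"

definition conic_hausdorff :: "'a::euclidean_space set \<Rightarrow> 'a set \<Rightarrow> real" where
  "conic_hausdorff C D =
    Inf {\<alpha>. 0 \<le> \<alpha> \<and> D \<subseteq> angular_expansion C \<alpha> \<and> C \<subseteq> angular_expansion D \<alpha>}"

definition std_gaussian :: "'a::euclidean_space measure" where
  "std_gaussian = density lborel (\<lambda>x. ennreal (\<Prod>b\<in>Basis. std_normal_density (x \<bullet> b)))"

text \<open>The metric projector is the library's \<open>closest_point\<close>.  Every face contains 0, so its
  affine hull is its linear hull, and \<open>rel_interior\<close> and \<open>dim\<close> both refer to the linear hull.\<close>

definition polyhedral_intrinsic_volume :: "'a::euclidean_space set \<Rightarrow> nat \<Rightarrow> real" where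
  "polyhedral_intrinsic_volume C k =
    measure std_gaussian
      {g. \<exists>F\<in>cone_faces C. dim F = k \<and> closest_point C g \<in> rel_interior F}"

text \<open>The non-polyhedral case: the common limit along all approximating sequences of polyhedral
  cones.  Uniqueness of \<open>l\<close> comes from the density of the polyhedral cones, existence from the
  continuity of the intrinsic volumes.\<close>

definition conic_intrinsic_volume :: "'a::euclidean_space set \<Rightarrow> nat \<Rightarrow> real" where
  "conic_intrinsic_volume C k =
    (if polyhedral_cone C then polyhedral_intrinsic_volume C k
     else THE l. \<forall>P :: nat \<Rightarrow> 'a set.
       (\<forall>i. polyhedral_cone (P i)) \<longrightarrow> (\<lambda>i. conic_hausdorff (P i) C) \<longlonglongrightarrow> 0 \<longrightarrow>
       (\<lambda>i. polyhedral_intrinsic_volume (P i) k) \<longlonglongrightarrow> l)"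

text \<open>The law of the intrinsic volume random variable \<open>V\<^sub>C\<close>.\<close>

definition intrinsic_volume_pmf :: "'a::euclidean_space set \<Rightarrow> nat pmf" where
  "intrinsic_volume_pmf C =
    embed_pmf (\<lambda>k. if k \<le> DIM('a) then conic_intrinsic_volume C k else 0)"

definition statistical_dimension :: "'a::euclidean_space set \<Rightarrow> real" where
  "statistical_dimension C = measure_pmf.expectation (intrinsic_volume_pmf C) real"

text \<open>At \<open>u = - 1\<close> the convention \<open>0 * ln 0 = 0\<close> gives the intended value 1.\<close>

definition psi :: "real \<Rightarrow> ereal" where
  "psi u = (if - 1 \<le> u then ereal ((1 + u) * ln (1 + u) - u) else \<infinity>)"

text \<open>The expression \<open>\<delta> \<cdot> \<psi>(t / \<delta>)\<close>.  For \<open>\<delta> = 0\<close> it is given its limit as \<open>\<delta>\<close> decreases to 0,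
  which is \<open>\<infinity>\<close> if \<open>t \<noteq> 0\<close> and 0 if \<open>t = 0\<close>; the plain \<open>ereal\<close> product would always be 0.\<close>

definition scaled_psi :: "real \<Rightarrow> real \<Rightarrow> ereal" where
  "scaled_psi \<delta> t = (if \<delta> = 0 \<and> t \<noteq> 0 then \<infinity> else ereal \<delta> * psi (t / \<delta>))"

definition exp_ereal :: "ereal \<Rightarrow> ereal" where
  "exp_ereal x = (case x of ereal r \<Rightarrow> ereal (exp r) | PInfty \<Rightarrow> \<infinity> | MInfty \<Rightarrow> 0)"

end

theory Submission
  imports Defs "HOL-Real_Asymp.Real_Asymp"
begin

text \<open>Write \<open>\<Pi>\<close> for the projector onto \<open>C\<close>. By the Steiner formula, the integral of
  \<open>exp (- \<parallel>\<Pi> x\<parallel>\<^sup>2 / (2 s) - \<parallel>x - \<Pi> x\<parallel>\<^sup>2 / 2)\<close>, normalised to 1 at \<open>s = 1\<close>, is the generating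
  function of \<open>V\<^sub>C\<close> at \<open>sqrt s\<close>: for polyhedral cones by stretching each region
  \<open>{x. \<Pi> x \<in> rel_interior F}\<close> along the span of the face \<open>F\<close>, in general by approximation, since
  polynomials of bounded degree that converge pointwise have converging coefficients.
  The exponent is jointly convex in \<open>(s, x)\<close>, so by the Prekopa-Leindler inequality the integral is
  log-concave in \<open>s\<close> along segments from \<open>s = 1\<close>. Comparing with the tangent at \<open>s = 1\<close> gives
  \<open>E exp (\<eta> V\<^sub>C) \<le> exp (\<delta>(C) (exp (2 \<eta>) - 1) / 2)\<close> for all real \<open>\<eta>\<close>, and Chernoff's method applied
  to \<open>V\<^sub>C\<close> and to the variable \<open>d - V\<^sub>C\<close> of the polar cone gives the tail bounds.\<close>

subsection \<open>The Prekopa-Leindler inequality\<close>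

text \<open>The bound on E exp (\<eta> V) says that V has a moment generating function no larger
  than that of twice a Poisson variable of mean \<delta>/2. Its Legendre transform at \<delta> +
  \<lambda> is \<delta> \<psi>(\<lambda>/\<delta>) / 2, which explains both \<psi> and the factor
  1/2 in the tail bounds. The 2 in exp (2 \<eta>) is there because the generating function is
  evaluated at exp \<eta> = sqrt s, while convexity holds in s. The point s = 1 is special because
  the weight there is the standard Gaussian for every cone and has mass 1. Moreover a segment
  starting at 1 stays on one side of 1, and the convex representation of the exponent differs on the
  two sides. Poisson tails are not symmetric, so the estimates obtained from the polar cone do not
  follow from those for C; hence the maximum. A general cone has its intrinsic volumes only as
  limits. The Gaussian integral is defined for every closed convex cone and is continuous in the
  cone, so log-concavity and polarity are proved for the integral and transferred to the intrinsic
  volumes by comparing coefficients.\<close>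

lemma emeasure_lborel_translate:
  fixes A :: "real set"
  assumes [measurable]: "A \<in> sets borel"
  shows "emeasure lborel {x. x - b \<in> A} = emeasure lborel A"
proof -
  have "emeasure lborel {x. x - b \<in> A} = (\<integral>\<^sup>+x. indicator A (x - b) \<partial>lborel)"
    by (subst nn_integral_indicator[symmetric])
      (auto intro!: nn_integral_cong simp: indicator_def simp del: nn_integral_indicator)
  also have "\<dots> = emeasure lborel A"
    by (subst nn_integral_real_affine[where c = 1 and t = b]) auto
  finally show ?thesis .
qed

lemma emeasure_lborel_halve:
  fixes A :: "real set"
  assumes [measurable]: "A \<in> sets borel"
  shows "emeasure lborel {x. x / 2 \<in> A} = 2 * emeasure lborel A"
proof -
  have "emeasure lborel {x. x / 2 \<in> A} = (\<integral>\<^sup>+x. indicator A (x / 2) \<partial>lborel)"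
    by (subst nn_integral_indicator[symmetric])
      (auto intro!: nn_integral_cong simp: indicator_def simp del: nn_integral_indicator)
  also have "\<dots> = 2 * emeasure lborel A"
    by (subst nn_integral_real_affine[where c = 2 and t = 0]) auto
  finally show ?thesis .
qed

text \<open>With \<open>a\<close> almost the supremum of \<open>A\<close> and \<open>b\<close>
  almost the infimum of \<open>B\<close>, the translates \<open>A + b\<close> and
  \<open>a + B\<close> both lie in \<open>2 M\<close> and overlap only in an interval of length less
  than \<open>e\<close>. The points are only nearly extremal because the sets need not be closed. A
  measurable \<open>M\<close> stands in for the half sum of \<open>A\<close> and \<open>B\<close>,
  which need not be Borel.\<close>

lemma Brunn_Minkowski_real_bounded:
  fixes A B M :: "real set"
  assumes [measurable]: "A \<in> sets borel" "B \<in> sets borel" "M \<in> sets borel"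
    and ne: "A \<noteq> {}" "B \<noteq> {}"
    and bdd: "bounded A" "bounded B"
    and mid: "\<And>a b. a \<in> A \<Longrightarrow> b \<in> B \<Longrightarrow> (a + b) / 2 \<in> M"
  shows "emeasure lborel A + emeasure lborel B \<le> 2 * emeasure lborel M"
proof (rule ennreal_le_epsilon)
  fix e :: real assume e: "e > 0"
  have bA: "bdd_above A" and bB: "bdd_below B"
    using bdd by (auto simp: bounded_imp_bdd_above bounded_imp_bdd_below)
  obtain a where a: "a \<in> A" "a > Sup A - e / 2"
    using less_cSup_iff[OF ne(1) bA, of "Sup A - e/2"] e by auto
  obtain b where b: "b \<in> B" "b < Inf B + e / 2"
    using cInf_less_iff[OF ne(2) bB, of "Inf B + e/2"] e by auto
  let ?A = "{x. x - b \<in> A}" and ?B = "{x. x - a \<in> B}"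
  have [measurable]: "?A \<in> sets borel" "?B \<in> sets borel" by measurable
  have int: "?A \<inter> ?B \<subseteq> {Inf B + a..Sup A + b}"
  proof
    fix x assume "x \<in> ?A \<inter> ?B"
    then have "x - b \<le> Sup A" "Inf B \<le> x - a"
      using cSup_upper[OF _ bA] cInf_lower[OF _ bB] by auto
    then show "x \<in> {Inf B + a..Sup A + b}" by (simp add: algebra_simps)
  qed
  have "emeasure lborel (?A \<inter> ?B) \<le> emeasure lborel {Inf B + a..Sup A + b}"
    by (rule emeasure_mono[OF int]) simp
  also have "\<dots> \<le> ennreal e"
    unfolding emeasure_lborel_Icc_eq using a b e by (auto intro!: ennreal_leI)
  finally have I: "emeasure lborel (?A \<inter> ?B) \<le> ennreal e" .
  have U: "emeasure lborel (?A \<union> ?B) \<le> 2 * emeasure lborel M"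
  proof -
    have "?A \<union> ?B \<subseteq> {x. x / 2 \<in> M}"
    proof
      fix x assume "x \<in> ?A \<union> ?B"
      then show "x \<in> {x. x / 2 \<in> M}"
        using mid[of "x - b" b] mid[of a "x - a"] a b by auto
    qed
    then have "emeasure lborel (?A \<union> ?B) \<le> emeasure lborel {x. x / 2 \<in> M}"
      by (intro emeasure_mono) auto
    then show ?thesis by (simp add: emeasure_lborel_halve)
  qed
  have "emeasure lborel A + emeasure lborel B = emeasure lborel ?A + emeasure lborel ?B"
    by (simp add: emeasure_lborel_translate)
  also have "\<dots> = emeasure lborel (?A \<union> ?B) + emeasure lborel (?A \<inter> ?B)"
    by (rule emeasure_Un_Int) auto
  also have "\<dots> \<le> 2 * emeasure lborel M + ennreal e"
    by (intro add_mono U I)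
  finally show "emeasure lborel A + emeasure lborel B \<le> 2 * emeasure lborel M + ennreal e" .
qed

lemma Brunn_Minkowski_real:
  fixes A B M :: "real set"
  assumes [measurable]: "A \<in> sets borel" "B \<in> sets borel" "M \<in> sets borel"
    and ne: "A \<noteq> {}" "B \<noteq> {}"
    and mid: "\<And>a b. a \<in> A \<Longrightarrow> b \<in> B \<Longrightarrow> (a + b) / 2 \<in> M"
  shows "emeasure lborel A + emeasure lborel B \<le> 2 * emeasure lborel M"
proof -
  let ?I = "\<lambda>n. {- real n..real n}"
  have lim: "(\<lambda>n. emeasure lborel (S \<inter> ?I n)) \<longlonglongrightarrow> emeasure lborel S"
    if [measurable]: "S \<in> sets borel" for S
  proof -
    have "(\<lambda>n. emeasure lborel (S \<inter> ?I n)) \<longlonglongrightarrow> emeasure lborel (\<Union>n. S \<inter> ?I n)"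
      by (rule Lim_emeasure_incseq) (auto simp: incseq_def)
    moreover have "(\<Union>n. S \<inter> ?I n) = S"
    proof -
      have "\<exists>n. - real n \<le> x \<and> x \<le> real n" for x
        using real_arch_simple[of "\<bar>x\<bar>"] by (auto simp: abs_le_iff minus_le_iff)
      then show ?thesis by auto
    qed
    ultimately show ?thesis by simp
  qed
  obtain a b where ab: "a \<in> A" "b \<in> B" using ne by auto
  \<comment> \<open>From \<open>N\<close> on both truncations contain \<open>a\<close> and
    \<open>b\<close> respectively; the bounded case fails for an empty set.\<close>
  obtain N where N: "max \<bar>a\<bar> \<bar>b\<bar> \<le> real N" using real_arch_simple by blast
  have "(\<lambda>n. emeasure lborel (A \<inter> ?I n) + emeasure lborel (B \<inter> ?I n)) \<longlonglongrightarrow>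
      emeasure lborel A + emeasure lborel B"
    by (intro tendsto_add lim) auto
  then show ?thesis
  proof (rule Lim_bounded)
    show "\<forall>n\<ge>N. emeasure lborel (A \<inter> ?I n) + emeasure lborel (B \<inter> ?I n) \<le> 2 * emeasure lborel M"
    proof (intro allI impI Brunn_Minkowski_real_bounded)
      fix n assume "n \<ge> N"
      then have "max \<bar>a\<bar> \<bar>b\<bar> \<le> real n" using N by linarith
      then have "a \<in> A \<inter> ?I n" "b \<in> B \<inter> ?I n" using ab by auto
      then show "A \<inter> ?I n \<noteq> {}" "B \<inter> ?I n \<noteq> {}" by auto
    qed (auto intro: mid bounded_Int)
  qed
qed

text \<open>Heights are measured relative to \<open>c\<close>, so that functions with different
  suprema can be compared at the same relative height \<open>r\<close>. The truncation is harmless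
  for a function bounded by \<open>c\<close> and gives a lower bound for any other.\<close>

lemma layer_cake_min:
  fixes f :: "real \<Rightarrow> ennreal" and c :: real
  assumes [measurable]: "f \<in> borel_measurable borel" and c: "c > 0"
  shows "(\<integral>\<^sup>+x. min (f x) (ennreal c) \<partial>lborel) =
    ennreal c * (\<integral>\<^sup>+r. emeasure lborel {x. ennreal (c * r) < f x} * indicator {0..<1} r \<partial>lborel)"
proof -
  have pt: "min (f x) (ennreal c) =
      ennreal c * (\<integral>\<^sup>+r. indicator {r. 0 \<le> r \<and> r < 1 \<and> ennreal (c * r) < f x} r \<partial>lborel)" for x
  proof (cases "f x")
    case (real u)
    have "{r. 0 \<le> r \<and> r < 1 \<and> ennreal (c * r) < f x} = {0..<min 1 (u / c)}"
      using real c by (auto simp: ennreal_less_iff field_simps)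
    then show ?thesis using real c
      by (auto simp: min_def ennreal_mult[symmetric] field_simps)
  next
    case top
    then have "{r. 0 \<le> r \<and> r < 1 \<and> ennreal (c * r) < f x} = {0..<1}" by auto
    then show ?thesis using top by (simp add: min_def top_unique)
  qed
  have "(\<integral>\<^sup>+x. min (f x) (ennreal c) \<partial>lborel) = ennreal c *
     (\<integral>\<^sup>+x. \<integral>\<^sup>+r. indicator {r. 0 \<le> r \<and> r < 1 \<and> ennreal (c * r) < f x} r \<partial>lborel \<partial>lborel)"
    unfolding pt by (rule nn_integral_cmult) (measurable)
  also have "(\<integral>\<^sup>+x. \<integral>\<^sup>+r. indicator {r. 0 \<le> r \<and> r < 1 \<and> ennreal (c * r) < f x} r \<partial>lborel \<partial>lborel) =
     (\<integral>\<^sup>+r. \<integral>\<^sup>+x. indicator {r. 0 \<le> r \<and> r < 1 \<and> ennreal (c * r) < f x} r \<partial>lborel \<partial>lborel)"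
    by (rule lborel_pair.Fubini') measurable
  also have "\<dots> = (\<integral>\<^sup>+r. emeasure lborel {x. ennreal (c * r) < f x} * indicator {0..<1} r \<partial>lborel)"
  proof (rule nn_integral_cong)
    fix r :: real
    have "(\<integral>\<^sup>+x. indicator {r. 0 \<le> r \<and> r < 1 \<and> ennreal (c * r) < f x} r \<partial>lborel) =
       (\<integral>\<^sup>+x. indicator {x. ennreal (c * r) < f x} x * indicator {0..<1} r \<partial>lborel)"
      by (rule nn_integral_cong) (auto simp: indicator_def)
    also have "\<dots> = emeasure lborel {x. ennreal (c * r) < f x} * indicator {0..<1} r"
      by (subst nn_integral_multc) auto
    finally show "(\<integral>\<^sup>+x. indicator {r. 0 \<le> r \<and> r < 1 \<and> ennreal (c * r) < f x} r \<partial>lborel) =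
      emeasure lborel {x. ennreal (c * r) < f x} * indicator {0..<1} r" .
  qed
  finally show ?thesis .
qed

lemma ennreal_four_mult_le_square_add:
  fixes X Y :: ennreal
  shows "4 * (X * Y) \<le> (X + Y)\<^sup>2"
proof (cases X; cases Y)
  fix x y assume "0 \<le> x" "X = ennreal x" "0 \<le> y" "Y = ennreal y"
  moreover have "4 * (x * y) \<le> (x + y)\<^sup>2"
    using zero_le_power2[of "x - y"] by (simp add: power2_eq_square algebra_simps)
  ultimately have "ennreal 4 * (X * Y) \<le> (X + Y)\<^sup>2"
    by (simp add: ennreal_mult[symmetric] ennreal_plus[symmetric] ennreal_power ennreal_leI
        del: ennreal_plus ennreal_numeral)
  then show ?thesis by simp
qed (simp_all add: power2_eq_square ennreal_top_mult)

text \<open>After division by their suprema, \<open>f\<close> and \<open>g\<close> have nonempty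
  superlevel sets at every relative height below 1, so Brunn-Minkowski on the line applies to them.
  Integration over the height gives F + G \<le> 2 H, and the arithmetic-geometric mean inequality
  turns this into F G \<le> H^2. Boundedness serves to make the suprema finite.\<close>

lemma Prekopa_Leindler_real_bounded:
  fixes f g h :: "real \<Rightarrow> ennreal" and K :: real
  assumes [measurable]: "f \<in> borel_measurable borel" "g \<in> borel_measurable borel" "h \<in> borel_measurable borel"
    and bdd: "\<And>x. f x \<le> ennreal K" "\<And>x. g x \<le> ennreal K"
    and le: "\<And>x y. f x * g y \<le> (h ((x + y) / 2))\<^sup>2"
  shows "(\<integral>\<^sup>+x. f x \<partial>lborel) * (\<integral>\<^sup>+x. g x \<partial>lborel) \<le> (\<integral>\<^sup>+x. h x \<partial>lborel)\<^sup>2"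
proof -
  have "(SUP x. f x) \<le> ennreal K" "(SUP x. g x) \<le> ennreal K"
    using bdd by (auto intro: SUP_least)
  then have "(SUP x. f x) \<noteq> top" "(SUP x. g x) \<noteq> top"
    by (metis ennreal_less_top leD top.not_eq_extremum)+
  then obtain a b where a: "(SUP x. f x) = ennreal a" "a \<ge> 0" and b: "(SUP x. g x) = ennreal b" "b \<ge> 0"
    by (metis ennreal_cases)
  have fa: "f x \<le> ennreal a" and gb: "g x \<le> ennreal b" for x
    using a b by (metis SUP_upper UNIV_I)+
  consider "a = 0" | "b = 0" | "a > 0" "b > 0" using a b by linarith
  then show ?thesis
  proof cases
    case 1
    then have "f x = 0" for x using fa[of x] by simp
    then show ?thesis by simp
  next
    case 2
    then have "g x = 0" for x using gb[of x] by simp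
    then show ?thesis by simp
  next
    case 3
    \<comment> \<open>The geometric mean is the height for \<open>h\<close> that matches
      \<open>a\<close> and \<open>b\<close>: the level of \<open>f\<close> times the level of
      \<open>g\<close> is the square of the level \<open>c * r\<close>.\<close>
    define c where "c = sqrt (a * b)"
    have c: "c > 0" "c\<^sup>2 = a * b" using 3 by (auto simp: c_def)
    define F G H where "F = (\<integral>\<^sup>+r. emeasure lborel {x. ennreal (a * r) < f x} * indicator {0..<1} r \<partial>lborel)"
      and "G = (\<integral>\<^sup>+r. emeasure lborel {x. ennreal (b * r) < g x} * indicator {0..<1} r \<partial>lborel)"
      and "H = (\<integral>\<^sup>+r. emeasure lborel {x. ennreal (c * r) < h x} * indicator {0..<1} r \<partial>lborel)"
    have f_eq: "(\<integral>\<^sup>+x. f x \<partial>lborel) = ennreal a * F"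
      using layer_cake_min[of f a] 3 fa by (simp add: F_def min_absorb1)
    have g_eq: "(\<integral>\<^sup>+x. g x \<partial>lborel) = ennreal b * G"
      using layer_cake_min[of g b] 3 gb by (simp add: G_def min_absorb1)
    \<comment> \<open>Only an inequality: \<open>h\<close> may exceed \<open>c\<close>.\<close>
    have h_ge: "ennreal c * H \<le> (\<integral>\<^sup>+x. h x \<partial>lborel)"
      using layer_cake_min[of h c] c
      by (metis (no_types, lifting) H_def assms(3) min.cobounded1 nn_integral_mono)
    have level: "emeasure lborel {x. ennreal (a * r) < f x} + emeasure lborel {x. ennreal (b * r) < g x}
        \<le> 2 * emeasure lborel {x. ennreal (c * r) < h x}" if r: "0 \<le> r" "r < 1" for r
    proof (rule Brunn_Minkowski_real)
      have "ennreal (a * r) < (SUP x. f x)" "ennreal (b * r) < (SUP x. g x)"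
        unfolding a b using r 3 by (auto simp: ennreal_less_iff)
      then show "{x. ennreal (a * r) < f x} \<noteq> {}" "{x. ennreal (b * r) < g x} \<noteq> {}"
        by (auto simp: less_SUP_iff)
      fix x y assume "x \<in> {x. ennreal (a * r) < f x}" "y \<in> {x. ennreal (b * r) < g x}"
      then have xy: "ennreal (a * r) < f x" "ennreal (b * r) < g y" by auto
      have "ennreal (c * r) ^ 2 = ennreal (a * r) * ennreal (b * r)"
        using c r 3 by (simp add: ennreal_power ennreal_mult[symmetric] power_mult_distrib power2_eq_square mult_ac)
      also have "\<dots> < f x * g y"
        using xy fa[of x] gb[of y] r 3
        by (cases "f x"; cases "g y")
          (auto simp: ennreal_mult[symmetric] ennreal_less_iff top_unique intro!: mult_strict_mono')
      also have "\<dots> \<le> (h ((x + y) / 2))\<^sup>2" by (rule le)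
      finally have "ennreal (c * r) ^ 2 < (h ((x + y) / 2))\<^sup>2" .
      then have "ennreal (c * r) < h ((x + y) / 2)"
        by (metis not_le power_mono zero_le)
      then show "(x + y) / 2 \<in> {x. ennreal (c * r) < h x}" by simp
    qed measurable
    have "F + G = (\<integral>\<^sup>+r. (emeasure lborel {x. ennreal (a * r) < f x} + emeasure lborel {x. ennreal (b * r) < g x})
        * indicator {0..<1} r \<partial>lborel)"
      unfolding F_def G_def by (subst nn_integral_add[symmetric]) (auto simp: distrib_right)
    also have "\<dots> \<le> (\<integral>\<^sup>+r. 2 * (emeasure lborel {x. ennreal (c * r) < h x} * indicator {0..<1} r) \<partial>lborel)"
      by (rule nn_integral_mono) (auto simp: level indicator_def)
    also have "\<dots> = 2 * H"
      unfolding H_def by (rule nn_integral_cmult) measurable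
    finally have FGH: "F + G \<le> 2 * H" .
    have "4 * (F * G) \<le> (2 * H)\<^sup>2"
      using ennreal_four_mult_le_square_add[of F G] power_mono[OF FGH, of 2] by (meson order_trans zero_le)
    also have "\<dots> = 4 * H\<^sup>2" by (simp add: power_mult_distrib)
    finally have "4 * (F * G) \<le> 4 * H\<^sup>2" .
    then have FG: "F * G \<le> H\<^sup>2"
      by (subst (asm) ennreal_mult_le_mult_iff) auto
    have "(\<integral>\<^sup>+x. f x \<partial>lborel) * (\<integral>\<^sup>+x. g x \<partial>lborel) = ennreal c ^ 2 * (F * G)"
      unfolding f_eq g_eq using c 3 by (simp add: ennreal_power ennreal_mult mult_ac)
    also have "\<dots> \<le> ennreal c ^ 2 * H\<^sup>2" by (rule mult_left_mono[OF FG]) simp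
    also have "\<dots> = (ennreal c * H)\<^sup>2" by (simp add: power_mult_distrib)
    also have "\<dots> \<le> (\<integral>\<^sup>+x. h x \<partial>lborel)\<^sup>2" by (rule power_mono[OF h_ge]) simp
    finally show ?thesis .
  qed
qed

text \<open>Lowering \<open>f\<close> and \<open>g\<close> preserves the hypothesis, so both may be
  cut off at integers and recovered by monotone convergence.\<close>

lemma Prekopa_Leindler_real:
  fixes f g h :: "real \<Rightarrow> ennreal"
  assumes [measurable]: "f \<in> borel_measurable borel" "g \<in> borel_measurable borel" "h \<in> borel_measurable borel"
    and le: "\<And>x y. f x * g y \<le> (h ((x + y) / 2))\<^sup>2"
  shows "(\<integral>\<^sup>+x. f x \<partial>lborel) * (\<integral>\<^sup>+x. g x \<partial>lborel) \<le> (\<integral>\<^sup>+x. h x \<partial>lborel)\<^sup>2"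
proof -
  have trunc: "(SUP n. \<integral>\<^sup>+x. min (u x) (of_nat n) \<partial>lborel) = (\<integral>\<^sup>+x. u x \<partial>lborel)"
    if [measurable]: "u \<in> borel_measurable borel" for u :: "real \<Rightarrow> ennreal"
  proof -
    have inc: "incseq (\<lambda>n x. min (u x) (of_nat n))"
      by (auto simp: incseq_def le_fun_def min_le_iff_disj intro: min.coboundedI2)
    have "(\<integral>\<^sup>+x. (SUP n. min (u x) (of_nat n)) \<partial>lborel) = (SUP n. \<integral>\<^sup>+x. min (u x) (of_nat n) \<partial>lborel)"
      by (rule nn_integral_monotone_convergence_SUP[OF inc]) measurable
    moreover have "(SUP n. min (u x) (of_nat n)) = u x" for x
      by (metis ennreal_SUP_of_nat_eq_top inf_SUP inf_min inf_top.right_neutral)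
    ultimately show "(SUP n. \<integral>\<^sup>+x. min (u x) (of_nat n) \<partial>lborel) = (\<integral>\<^sup>+x. u x \<partial>lborel)" by simp
  qed
  have b: "(\<integral>\<^sup>+x. min (f x) (of_nat n) \<partial>lborel) * (\<integral>\<^sup>+x. min (g x) (of_nat m) \<partial>lborel)
      \<le> (\<integral>\<^sup>+x. h x \<partial>lborel)\<^sup>2" for n m
  proof (rule Prekopa_Leindler_real_bounded[where K = "max (real n) (real m)"])
    show "min (f x) (of_nat n) * min (g y) (of_nat m) \<le> (h ((x + y) / 2))\<^sup>2" for x y
      using le[of x y] mult_mono[of "min (f x) (of_nat n)" "f x" "min (g y) (of_nat m)" "g y"]
      by (meson min.cobounded1 order_trans zero_le)
  qed (auto simp: ennreal_of_nat_eq_real_of_nat min.coboundedI2 ennreal_leI)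
  show ?thesis
    unfolding trunc[OF assms(1), symmetric] trunc[OF assms(2), symmetric]
    by (auto simp: SUP_mult_left_ennreal SUP_mult_right_ennreal intro!: SUP_least b)
qed

text \<open>Induction on the coordinates: integrating out one of them by the one-dimensional
  inequality yields three functions of the remaining coordinates that again satisfy the pointwise
  hypothesis.\<close>

lemma Prekopa_Leindler_PiM:
  fixes I :: "'i set" and f g h :: "('i \<Rightarrow> real) \<Rightarrow> ennreal"
  assumes "finite I"
    and "f \<in> borel_measurable (\<Pi>\<^sub>M i\<in>I. lborel)" "g \<in> borel_measurable (\<Pi>\<^sub>M i\<in>I. lborel)"
      "h \<in> borel_measurable (\<Pi>\<^sub>M i\<in>I. lborel)"
    and "\<And>x y. x \<in> space (\<Pi>\<^sub>M i\<in>I. lborel) \<Longrightarrow> y \<in> space (\<Pi>\<^sub>M i\<in>I. lborel) \<Longrightarrow>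
      f x * g y \<le> (h (\<lambda>i\<in>I. (x i + y i) / 2))\<^sup>2"
  shows "(\<integral>\<^sup>+x. f x \<partial>(\<Pi>\<^sub>M i\<in>I. lborel)) * (\<integral>\<^sup>+x. g x \<partial>(\<Pi>\<^sub>M i\<in>I. lborel))
    \<le> (\<integral>\<^sup>+x. h x \<partial>(\<Pi>\<^sub>M i\<in>I. lborel))\<^sup>2"
  using assms
proof (induction I arbitrary: f g h rule: finite_induct)
  case empty
  have s: "(\<lambda>_. undefined) \<in> space (\<Pi>\<^sub>M i\<in>{}. (lborel::real measure))" by (simp add: space_PiM)
  show ?case
    using empty.prems(4)[OF s s] by (simp add: nn_integral_empty PiM_empty nn_integral_count_space_finite restrict_def)
next
  case (insert i I)
  interpret product_sigma_finite "\<lambda>_::'i. lborel :: real measure" by standard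
  let ?P = "\<Pi>\<^sub>M i\<in>I. (lborel :: real measure)"
  note [measurable] = insert.prems(1-3)
  note eq = product_nn_integral_insert[OF insert.hyps]
  show ?case
    unfolding eq[OF insert.prems(1)] eq[OF insert.prems(2)] eq[OF insert.prems(3)]
  proof (rule insert.IH)
    fix x y assume xy: "x \<in> space ?P" "y \<in> space ?P"
    note [measurable] = xy
    have m: "(\<lambda>i\<in>I. (x i + y i) / 2) \<in> space ?P" by (simp add: space_PiM)
    note [measurable] = m
    show "(\<integral>\<^sup>+s. f (x(i := s)) \<partial>lborel) * (\<integral>\<^sup>+s. g (y(i := s)) \<partial>lborel)
       \<le> (\<integral>\<^sup>+s. h ((\<lambda>i\<in>I. (x i + y i) / 2)(i := s)) \<partial>lborel)\<^sup>2"
    proof (rule Prekopa_Leindler_real)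
      fix s t :: real
      have "x(i := s) \<in> space (\<Pi>\<^sub>M i\<in>insert i I. lborel)" "y(i := t) \<in> space (\<Pi>\<^sub>M i\<in>insert i I. lborel)"
        using xy by (auto simp: space_PiM PiE_def extensional_def)
      from insert.prems(4)[OF this]
      have "f (x(i := s)) * g (y(i := t)) \<le>
        (h (\<lambda>j\<in>insert i I. ((x(i := s)) j + (y(i := t)) j) / 2))\<^sup>2" .
      also have "(\<lambda>j\<in>insert i I. ((x(i := s)) j + (y(i := t)) j) / 2) =
          (\<lambda>i\<in>I. (x i + y i) / 2)(i := (s + t) / 2)"
        by (auto simp: fun_eq_iff restrict_def)
      finally show "f (x(i := s)) * g (y(i := t)) \<le> (h ((\<lambda>i\<in>I. (x i + y i) / 2)(i := (s + t) / 2)))\<^sup>2" .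
    qed measurable
  qed measurable
qed

theorem Prekopa_Leindler:
  fixes f g h :: "'a::euclidean_space \<Rightarrow> ennreal"
  assumes [measurable]: "f \<in> borel_measurable borel" "g \<in> borel_measurable borel" "h \<in> borel_measurable borel"
    and le: "\<And>x y. f x * g y \<le> (h ((x + y) /\<^sub>R 2))\<^sup>2"
  shows "(\<integral>\<^sup>+x. f x \<partial>lborel) * (\<integral>\<^sup>+x. g x \<partial>lborel) \<le> (\<integral>\<^sup>+x. h x \<partial>lborel)\<^sup>2"
proof -
  let ?P = "\<Pi>\<^sub>M b\<in>(Basis::'a set). (lborel :: real measure)"
  let ?S = "\<lambda>x. \<Sum>b\<in>(Basis::'a set). x b *\<^sub>R b"
  have tr: "(\<integral>\<^sup>+x. u x \<partial>lborel) = (\<integral>\<^sup>+x. u (?S x) \<partial>?P)"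
    if [measurable]: "u \<in> borel_measurable borel" for u :: "'a \<Rightarrow> ennreal"
    by (subst lborel_eq) (simp add: nn_integral_distr)
  show ?thesis
    unfolding tr[OF assms(1)] tr[OF assms(2)] tr[OF assms(3)]
  proof (rule Prekopa_Leindler_PiM)
    fix x y
    have "?S (\<lambda>i\<in>Basis. (x i + y i) / 2) = (?S x + ?S y) /\<^sub>R 2"
    proof -
      have "?S (\<lambda>i\<in>Basis. (x i + y i) / 2) = (\<Sum>b\<in>Basis. (x b *\<^sub>R b + y b *\<^sub>R b) /\<^sub>R 2)"
        by (rule sum.cong) (simp_all add: scaleR_add_left add_divide_distrib scaleR_add_right)
      then show ?thesis by (simp only: scaleR_sum_right scaleR_add_right sum.distrib)
    qed
    then show "f (?S x) * g (?S y) \<le> (h (?S (\<lambda>i\<in>Basis. (x i + y i) / 2)))\<^sup>2"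
      using le[of "?S x" "?S y"] by simp
  qed measurable
qed

subsection \<open>Linear change of variables\<close>

lemma nn_integral_lborel_translate:
  fixes f :: "'a::euclidean_space \<Rightarrow> ennreal"
  assumes [measurable]: "f \<in> borel_measurable borel"
  shows "(\<integral>\<^sup>+x. f (x + a) \<partial>lborel) = (\<integral>\<^sup>+x. f x \<partial>lborel)"
proof -
  have "(\<integral>\<^sup>+x. f x \<partial>lborel) = (\<integral>\<^sup>+x. f x \<partial>distr lborel borel (\<lambda>x. a + x))"
    by (simp add: lborel_distr_plus)
  also have "\<dots> = (\<integral>\<^sup>+x. f (x + a) \<partial>lborel)"
    by (simp add: nn_integral_distr add.commute)
  finally show ?thesis ..
qed

text \<open>Uniqueness of Haar measure, for the image of the Lebesgue measure under \<open>T\<close>: Fubini's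
  theorem and translation invariance turn the left-hand side into the right-hand side.\<close>

lemma nn_integral_lborel_linear_bij_exchange:
  fixes T :: "'a::euclidean_space \<Rightarrow> 'a" and f g :: "'a \<Rightarrow> ennreal"
  assumes T: "linear T" "bij T"
    and [measurable]: "f \<in> borel_measurable borel" "g \<in> borel_measurable borel"
  shows "(\<integral>\<^sup>+x. f (T x) \<partial>lborel) * (\<integral>\<^sup>+y. g y \<partial>lborel) =
    (\<integral>\<^sup>+x. f x \<partial>lborel) * (\<integral>\<^sup>+x. g (- T x) \<partial>lborel)"
proof -
  have [measurable]: "T \<in> borel_measurable borel"
    using T(1) by (intro borel_measurable_continuous_onI linear_continuous_on)
      (simp add: linear_conv_bounded_linear)
  have inv: "T (inv T y) = y" for y using T(2) by (simp add: bij_is_surj surj_f_inv_f)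
  have shift: "(\<integral>\<^sup>+x. u (T x + y) \<partial>lborel) = (\<integral>\<^sup>+x. u (T x) \<partial>lborel)"
    if [measurable]: "u \<in> borel_measurable borel" for u :: "'a \<Rightarrow> ennreal" and y
    using nn_integral_lborel_translate[of "\<lambda>x. u (T x)" "inv T y"]
    by (simp add: linear_add[OF T(1)] inv)
  have "(\<integral>\<^sup>+x. f (T x) \<partial>lborel) * (\<integral>\<^sup>+y. g y \<partial>lborel) =
      (\<integral>\<^sup>+y. \<integral>\<^sup>+x. f (T x) * g y \<partial>lborel \<partial>lborel)"
    by (simp add: nn_integral_cmult nn_integral_multc)
  also have "\<dots> = (\<integral>\<^sup>+y. \<integral>\<^sup>+x. f (T x + y) * g y \<partial>lborel \<partial>lborel)"
    by (simp add: nn_integral_multc shift)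
  also have "\<dots> = (\<integral>\<^sup>+x. \<integral>\<^sup>+y. f (T x + y) * g y \<partial>lborel \<partial>lborel)"
    by (rule lborel_pair.Fubini') measurable
  also have "\<dots> = (\<integral>\<^sup>+x. \<integral>\<^sup>+y. f y * g (y - T x) \<partial>lborel \<partial>lborel)"
  proof (rule nn_integral_cong)
    fix x
    show "(\<integral>\<^sup>+y. f (T x + y) * g y \<partial>lborel) = (\<integral>\<^sup>+y. f y * g (y - T x) \<partial>lborel)"
      using nn_integral_lborel_translate[of "\<lambda>y. f y * g (y - T x)" "T x"] by (simp add: add.commute)
  qed
  also have "\<dots> = (\<integral>\<^sup>+y. \<integral>\<^sup>+x. f y * g (y - T x) \<partial>lborel \<partial>lborel)"
    by (rule lborel_pair.Fubini') measurable
  also have "\<dots> = (\<integral>\<^sup>+y. f y * (\<integral>\<^sup>+x. g (- T x) \<partial>lborel) \<partial>lborel)"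
  proof (rule nn_integral_cong)
    fix y
    have "(\<integral>\<^sup>+x. g (y - T x) \<partial>lborel) = (\<integral>\<^sup>+x. g (- T x) \<partial>lborel)"
      using shift[of "\<lambda>w. g (- w)" "- y"] by simp
    then show "(\<integral>\<^sup>+x. f y * g (y - T x) \<partial>lborel) = f y * (\<integral>\<^sup>+x. g (- T x) \<partial>lborel)"
      by (simp add: nn_integral_cmult)
  qed
  also have "\<dots> = (\<integral>\<^sup>+x. f x \<partial>lborel) * (\<integral>\<^sup>+x. g (- T x) \<partial>lborel)"
    by (rule nn_integral_multc) measurable
  finally show ?thesis .
qed

text \<open>The exchange identity is tested on the unit ball, which is invariant under
  \<open>T\<close> and under negation; its measure is finite and nonzero and cancels.\<close>

lemma nn_integral_lborel_orthogonal:
  fixes T :: "'a::euclidean_space \<Rightarrow> 'a" and f :: "'a \<Rightarrow> ennreal"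
  assumes T: "orthogonal_transformation T" and f: "f \<in> borel_measurable borel"
  shows "(\<integral>\<^sup>+x. f (T x) \<partial>lborel) = (\<integral>\<^sup>+x. f x \<partial>lborel)"
proof -
  let ?b = "emeasure lborel (ball 0 1 :: 'a set)"
  have "(\<integral>\<^sup>+x. f (T x) \<partial>lborel) * (\<integral>\<^sup>+y. indicator (ball 0 1 :: 'a set) y \<partial>lborel) =
      (\<integral>\<^sup>+x. f x \<partial>lborel) * (\<integral>\<^sup>+x. indicator (ball 0 1) (- T x) \<partial>lborel)"
    using nn_integral_lborel_linear_bij_exchange[OF orthogonal_transformation_linear[OF T]
      orthogonal_transformation_bij[OF T] f, of "indicator (ball 0 1)"]
    by (simp add: borel_measurable_indicator)
  also have "(\<lambda>x. indicator (ball 0 1) (- T x)) = (indicator (ball 0 1) :: 'a \<Rightarrow> ennreal)"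
    using orthogonal_transformation_norm[OF T] by (auto simp: fun_eq_iff indicator_def)
  finally have "(\<integral>\<^sup>+x. f (T x) \<partial>lborel) * ?b = (\<integral>\<^sup>+x. f x \<partial>lborel) * ?b" by simp
  moreover have "?b \<noteq> 0"
    using open_not_negligible[of "ball (0::'a) 1"]
    by (auto simp: negligible_iff_null_sets null_sets_def emeasure_completion)
  moreover have "?b \<noteq> top"
    using emeasure_lborel_ball_finite[of "0::'a" 1] by auto
  ultimately show ?thesis
    by (metis ennreal_mult_divide_eq)
qed

text \<open>The Householder reflection across the hyperplane orthogonal to \<open>e - b\<close>.
  Being an involution, it is its own inverse when used for conjugation.\<close>

lemma orthogonal_reflection_exists:
  fixes e b :: "'a::euclidean_space"
  assumes "norm e = norm b"
  obtains U where "orthogonal_transformation U" "U e = b" "\<And>x. U (U x) = x"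
proof (cases "e = b")
  case True
  then show ?thesis using that[of "\<lambda>x. x"] by auto
next
  case False
  define v where "v = e - b"
  define U where "U x = x - (2 * (x \<bullet> v) / (v \<bullet> v)) *\<^sub>R v" for x
  have v: "v \<bullet> v \<noteq> 0" using False by (simp add: v_def)
  have eb: "e \<bullet> e = b \<bullet> b" using assms by (simp add: norm_eq_sqrt_inner)
  have lin: "linear U"
    by (rule linearI) (simp_all add: U_def inner_add_left algebra_simps add_divide_distrib scaleR_add_left)
  have UU: "U x \<bullet> U y = x \<bullet> y" for x y
    using v by (simp add: U_def inner_diff_left inner_diff_right inner_commute field_simps)
  have "2 * (e \<bullet> v) = v \<bullet> v"
    using eb by (simp add: v_def inner_diff_left inner_diff_right inner_commute)
  then have "U e = b" using v by (simp add: U_def) (simp add: v_def)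
  moreover have "U (U x) = x" for x
  proof -
    have "U x \<bullet> v = - (x \<bullet> v)" using v by (simp add: U_def inner_diff_left)
    then show ?thesis by (simp add: U_def[of "U x"]) (simp add: U_def)
  qed
  ultimately show ?thesis using that lin UU by (auto simp: orthogonal_transformation_def)
qed

text \<open>For an orthonormal \<open>B\<close>, scaling by \<open>z\<close> on the span of
  \<open>B\<close> and the identity on its orthogonal complement. Written as a sum over
  \<open>B\<close>, it factors into stretches along single vectors, which permits induction on
  \<open>B\<close>.\<close>

definition stretch :: "real \<Rightarrow> 'a::euclidean_space set \<Rightarrow> 'a \<Rightarrow> 'a" where
  "stretch z B x = x + (\<Sum>e\<in>B. ((z - 1) * (x \<bullet> e)) *\<^sub>R e)"

lemma measurable_stretch [measurable]: "stretch z B \<in> borel_measurable borel"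
  unfolding stretch_def[abs_def] by measurable

lemma nn_integral_stretch_basis:
  fixes f :: "'a::euclidean_space \<Rightarrow> ennreal"
  assumes [measurable]: "f \<in> borel_measurable borel" and z: "z > 0" and b: "b \<in> Basis"
  shows "ennreal z * (\<integral>\<^sup>+x. f (stretch z {b} x) \<partial>lborel) = (\<integral>\<^sup>+x. f x \<partial>lborel)"
proof -
  define c where "c = (\<lambda>j::'a. if j = b then z else 1)"
  have T: "0 + (\<Sum>j\<in>Basis. (c j * (x \<bullet> j)) *\<^sub>R j) = stretch z {b} x" for x
  proof -
    have "(\<Sum>j\<in>Basis. (c j * (x \<bullet> j)) *\<^sub>R j) =
        (\<Sum>j\<in>Basis. (x \<bullet> j) *\<^sub>R j + (if j = b then ((z - 1) * (x \<bullet> j)) *\<^sub>R j else 0))"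
      by (rule sum.cong) (auto simp: c_def algebra_simps)
    then show ?thesis using b by (simp add: sum.distrib euclidean_representation stretch_def)
  qed
  have "(\<integral>\<^sup>+x. f x \<partial>lborel) =
     (\<integral>\<^sup>+x. f x \<partial>density (distr lborel borel (stretch z {b})) (\<lambda>_. (\<Prod>j\<in>Basis. \<bar>c j\<bar>)))"
    using lborel_affine_euclidean[of c 0] z unfolding T by (simp add: c_def)
  also have "(\<Prod>j\<in>Basis. \<bar>c j\<bar>) = z"
    using b z by (simp add: c_def if_distrib[of abs] prod.delta cong: if_cong)
  finally show ?thesis using z
    by (simp add: nn_integral_density nn_integral_distr nn_integral_cmult)
qed

text \<open>Conjugation by a reflection that carries \<open>e\<close> to a basis vector reduces to a
  diagonal map, and the reflection preserves Lebesgue measure.\<close>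

lemma nn_integral_stretch_single:
  fixes f :: "'a::euclidean_space \<Rightarrow> ennreal"
  assumes [measurable]: "f \<in> borel_measurable borel" and z: "z > 0" and e: "norm e = 1"
  shows "ennreal z * (\<integral>\<^sup>+x. f (stretch z {e} x) \<partial>lborel) = (\<integral>\<^sup>+x. f x \<partial>lborel)"
proof -
  obtain b :: 'a where b: "b \<in> Basis" using nonempty_Basis by blast
  then obtain U where U: "orthogonal_transformation U" "U e = b" "\<And>x. U (U x) = x"
    using orthogonal_reflection_exists[of e b] e by auto
  have [measurable]: "U \<in> borel_measurable borel"
    using orthogonal_transformation_linear[OF U(1)]
    by (intro borel_measurable_continuous_onI linear_continuous_on)
      (simp add: linear_conv_bounded_linear)
  have Ub: "U b = e" using U by metis
  have inner: "U x \<bullet> b = x \<bullet> e" for x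
    using U(1,2) by (metis orthogonal_transformation_def)
  have conj: "stretch z {e} x = U (stretch z {b} (U x))" for x
    using orthogonal_transformation_linear[OF U(1)]
    by (simp add: stretch_def linear_add linear_cmul U(3) Ub inner)
  have "(\<integral>\<^sup>+x. f (stretch z {e} x) \<partial>lborel) = (\<integral>\<^sup>+x. f (U (stretch z {b} x)) \<partial>lborel)"
    unfolding conj by (rule nn_integral_lborel_orthogonal[OF U(1), of "\<lambda>x. f (U (stretch z {b} x))"]) measurable
  then have "ennreal z * (\<integral>\<^sup>+x. f (stretch z {e} x) \<partial>lborel) = (\<integral>\<^sup>+x. f (U x) \<partial>lborel)"
    using nn_integral_stretch_basis[of "\<lambda>x. f (U x)" z b] z b by simp
  also have "\<dots> = (\<integral>\<^sup>+x. f x \<partial>lborel)" by (rule nn_integral_lborel_orthogonal[OF U(1)]) measurable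
  finally show ?thesis .
qed

lemma nn_integral_stretch:
  fixes f :: "'a::euclidean_space \<Rightarrow> ennreal"
  assumes f: "f \<in> borel_measurable borel" and z: "z > 0"
    and B: "finite B" "pairwise orthogonal B" "\<And>e. e \<in> B \<Longrightarrow> norm e = 1"
  shows "ennreal (z ^ card B) * (\<integral>\<^sup>+x. f (stretch z B x) \<partial>lborel) = (\<integral>\<^sup>+x. f x \<partial>lborel)"
  using B f
proof (induction B arbitrary: f rule: finite_induct)
  case empty
  then show ?case by (simp add: stretch_def)
next
  case (insert e B)
  note [measurable] = insert.prems(3)
  \<comment> \<open>By orthogonality the stretch along \<open>B\<close> leaves the coordinate along
    \<open>e\<close> unchanged, so the two stretches compose without a cross term.\<close>
  have eq: "stretch z (insert e B) x = stretch z {e} (stretch z B x)" for x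
  proof -
    have "g \<bullet> e = 0" if "g \<in> B" for g
      using insert.prems(1) insert.hyps(2) that
      by (auto simp: pairwise_def orthogonal_def)
    then have "stretch z B x \<bullet> e = x \<bullet> e"
      by (simp add: stretch_def inner_add_left inner_sum_left)
    then show ?thesis using insert.hyps by (simp add: stretch_def[of z "{e}"]) (simp add: stretch_def add_ac)
  qed
  have "ennreal (z ^ card B) * (\<integral>\<^sup>+x. f (stretch z {e} (stretch z B x)) \<partial>lborel) =
      (\<integral>\<^sup>+x. f (stretch z {e} x) \<partial>lborel)"
    using insert.prems by (intro insert.IH) (auto simp: pairwise_insert)
  then have "ennreal z * (ennreal (z ^ card B) * (\<integral>\<^sup>+x. f (stretch z (insert e B) x) \<partial>lborel)) =
     (\<integral>\<^sup>+x. f x \<partial>lborel)"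
    using nn_integral_stretch_single[of f z e] insert.prems z by (simp add: eq)
  then show ?case using insert.hyps z by (simp add: ennreal_mult mult_ac)
qed

lemma stretch_inverse:
  assumes B: "finite B" "pairwise orthogonal B" "\<And>e. e \<in> B \<Longrightarrow> norm e = 1" and z: "z > 0"
  shows "stretch (1 / z) B (stretch z B x) = x"
proof -
  have e: "stretch z B x \<bullet> e = z * (x \<bullet> e)" if "e \<in> B" for e
  proof -
    have "(\<Sum>g\<in>B. ((z - 1) * (x \<bullet> g)) * (g \<bullet> e)) = (\<Sum>g\<in>B. if g = e then (z - 1) * (x \<bullet> e) else 0)"
      using B(2) B(3)[OF that] that
      by (intro sum.cong) (auto simp: pairwise_def orthogonal_def norm_eq_1)
    then show ?thesis using B(1) that
      by (simp add: stretch_def inner_add_left inner_sum_left algebra_simps)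
  qed
  have "stretch (1 / z) B (stretch z B x) =
      x + (\<Sum>e\<in>B. ((z - 1) * (x \<bullet> e)) *\<^sub>R e + ((1 / z - 1) * (z * (x \<bullet> e))) *\<^sub>R e)"
    unfolding stretch_def[of "1 / z"] by (simp add: e sum.distrib) (simp add: stretch_def)
  also have "\<dots> = x"
    using z by (simp add: algebra_simps flip: scaleR_add_left)
  finally show ?thesis .
qed

lemma linear_stretch: "linear (stretch z B)"
  unfolding stretch_def
  by (rule linearI)
     (simp_all add: inner_add_left scaleR_sum_right sum.distrib distrib_left scaleR_add_left
        scaleR_add_right mult.left_commute)

lemma stretch_span:
  assumes B: "finite B" "pairwise orthogonal B" "\<And>e. e \<in> B \<Longrightarrow> norm e = 1"
    and p: "p \<in> span B"
  shows "stretch z B p = z *\<^sub>R p"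
  using linear_stretch[of z B] linear_scale_self _ p
proof (rule linear_eq_on_span)
  fix e assume e: "e \<in> B"
  have "(\<Sum>g\<in>B. ((z - 1) * (e \<bullet> g)) *\<^sub>R g) = (\<Sum>g\<in>B. if g = e then (z - 1) *\<^sub>R e else 0)"
    using B(2) B(3)[OF e] e
    by (intro sum.cong) (auto simp: pairwise_def orthogonal_def norm_eq_1)
  then show "stretch z B e = z *\<^sub>R e"
    using B(1) e by (simp add: stretch_def algebra_simps)
qed

lemma stretch_orthogonal:
  assumes "\<And>e. e \<in> B \<Longrightarrow> x \<bullet> e = 0"
  shows "stretch z B x = x"
  using assms by (simp add: stretch_def)

subsection \<open>Projections onto closed convex cones\<close>

lemma closed_convex_coneD:
  assumes "closed_convex_cone C"
  shows "closed C" "convex C" "C \<noteq> {}" "0 \<in> C"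
    and "\<And>x y. x \<in> C \<Longrightarrow> y \<in> C \<Longrightarrow> x + y \<in> C"
    and "\<And>x c. x \<in> C \<Longrightarrow> 0 \<le> c \<Longrightarrow> c *\<^sub>R x \<in> C"
proof -
  have *: "closed C" "convex_cone C" using assms by (auto simp: closed_convex_cone_def)
  then show "closed C" "C \<noteq> {}" "0 \<in> C"
    by (auto simp: convex_cone_nonempty convex_cone_contains_0)
  show "convex C" using *(2) by (simp add: convex_cone_def)
  show "\<And>x y. x \<in> C \<Longrightarrow> y \<in> C \<Longrightarrow> x + y \<in> C"
    "\<And>x c. x \<in> C \<Longrightarrow> 0 \<le> c \<Longrightarrow> c *\<^sub>R x \<in> C"
    using *(2) by (auto simp: convex_cone_add convex_cone_scaleR)
qed

text \<open>One half of Moreau's decomposition. The variational inequality of the projection, tested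
  at \<open>0\<close> and at twice the projection, makes the residual orthogonal to the projection;
  what remains of the inequality puts the residual in the polar cone.\<close>

lemma closest_point_cone:
  fixes x :: "'a::euclidean_space"
  assumes C: "closed_convex_cone C"
  shows closest_point_cone_mem: "closest_point C x \<in> C"
    and closest_point_cone_orthogonal: "(x - closest_point C x) \<bullet> closest_point C x = 0"
    and closest_point_cone_polar: "y \<in> C \<Longrightarrow> (x - closest_point C x) \<bullet> y \<le> 0"
proof -
  note D = closed_convex_coneD[OF C]
  let ?p = "closest_point C x"
  show p: "?p \<in> C" using D by (intro closest_point_in_set)
  have dot: "(x - ?p) \<bullet> (y - ?p) \<le> 0" if "y \<in> C" for y
    using closest_point_dot[OF D(2,1) that] by simp
  have "(x - ?p) \<bullet> (2 *\<^sub>R ?p - ?p) \<le> 0" "(x - ?p) \<bullet> (0 - ?p) \<le> 0"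
    using p D by (intro dot; auto)+
  then show 0: "(x - ?p) \<bullet> ?p = 0" by (simp add: scaleR_2)
  show "(x - ?p) \<bullet> y \<le> 0" if "y \<in> C"
    using dot[OF that] 0 by (simp add: inner_diff_right)
qed

text \<open>The properties in Moreau's decomposition characterise the projection: combining those of
  \<open>p\<close> with those of the true projection \<open>q\<close> bounds the squared norm of
  \<open>q - p\<close> by 0.\<close>

lemma closest_point_cone_eqI:
  fixes x :: "'a::euclidean_space"
  assumes C: "closed_convex_cone C"
    and p: "p \<in> C" "(x - p) \<bullet> p = 0" "\<And>y. y \<in> C \<Longrightarrow> (x - p) \<bullet> y \<le> 0"
  shows "closest_point C x = p"
proof -
  note D = closed_convex_coneD[OF C]
  let ?q = "closest_point C x"
  have "(x - p) \<bullet> ?q \<le> 0" "(x - ?q) \<bullet> p \<le> 0" "(x - ?q) \<bullet> ?q = 0"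
    using p closest_point_cone[OF C] by auto
  then have "(?q - p) \<bullet> (?q - p) \<le> 0"
    using p(2) by (simp add: inner_diff_left inner_diff_right inner_commute)
  then show ?thesis by (metis eq_iff_diff_eq_0 inner_eq_zero_iff inner_ge_zero order_antisym)
qed

lemma norm_closest_point_cone:
  fixes x :: "'a::euclidean_space"
  assumes C: "closed_convex_cone C"
  shows "(norm x)\<^sup>2 = (norm (closest_point C x))\<^sup>2 + (norm (x - closest_point C x))\<^sup>2"
  using closest_point_cone_orthogonal[OF C, of x]
  by (simp add: power2_norm_eq_inner inner_diff_left inner_diff_right inner_commute)

lemma closed_convex_cone_polar: "closed_convex_cone (polar_cone C)"
proof -
  have eq: "polar_cone C = (\<Inter>x\<in>C. {u. x \<bullet> u \<le> 0})"
    by (auto simp: polar_cone_def inner_commute)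
  show ?thesis
    unfolding closed_convex_cone_def convex_cone_iff eq
    by (auto simp: closed_halfspace_le inner_add_right mult_nonneg_nonpos add_nonpos_nonpos
        intro!: closed_INT)
qed

text \<open>The other half of Moreau's decomposition; the criterion for projections is symmetric in
  a cone and its polar.\<close>

lemma closest_point_polar_cone:
  fixes x :: "'a::euclidean_space"
  assumes C: "closed_convex_cone C"
  shows "closest_point (polar_cone C) x = x - closest_point C x"
  using closest_point_cone[OF C, where x = x]
  by (intro closest_point_cone_eqI[OF closed_convex_cone_polar])
     (auto simp: polar_cone_def inner_commute)

lemma continuous_closest_point_cone:
  assumes C: "closed_convex_cone C"
  shows "continuous_on S (closest_point C)"
  using closed_convex_coneD[OF C] by (intro continuous_on_closest_point)

lemma closest_point_cone_scaleR:
  fixes x :: "'a::euclidean_space"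
  assumes C: "closed_convex_cone C" and c: "0 \<le> c"
  shows "closest_point C (c *\<^sub>R x) = c *\<^sub>R closest_point C x"
proof (rule closest_point_cone_eqI[OF C])
  let ?p = "closest_point C x"
  show "c *\<^sub>R ?p \<in> C" using closest_point_cone_mem[OF C] closed_convex_coneD[OF C] c by blast
  show "(c *\<^sub>R x - c *\<^sub>R ?p) \<bullet> (c *\<^sub>R ?p) = 0"
    using closest_point_cone_orthogonal[OF C, of x] by (simp flip: scaleR_diff_right)
  show "(c *\<^sub>R x - c *\<^sub>R ?p) \<bullet> y \<le> 0" if "y \<in> C" for y
    using closest_point_cone_polar[OF C that, where x = x] c
    by (simp add: mult_nonneg_nonpos flip: scaleR_diff_right)
qed

text \<open>The parameter is the variance \<open>s\<close>, not the scale z = sqrt s: the quotient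
  |p|^2 / s is jointly convex in (s, p), whereas |p|^2 / z^2 is not jointly convex in (z,
  p).\<close>

definition cone_energy :: "'a::euclidean_space set \<Rightarrow> real \<Rightarrow> 'a \<Rightarrow> real" where
  "cone_energy C s x = (norm (closest_point C x))\<^sup>2 / s + (norm (x - closest_point C x))\<^sup>2"

text \<open>Subadditivity of the perspective |a|^2 / \<alpha> of the squared norm. The two sides
  differ by |\<beta> a - \<alpha> b|^2 / (\<alpha> \<beta> (\<alpha> + \<beta>)).\<close>

lemma norm_add_square_divide_le:
  fixes a b :: "'a::real_inner"
  assumes "\<alpha> > 0" "\<beta> > 0"
  shows "(norm (a + b))\<^sup>2 / (\<alpha> + \<beta>) \<le> (norm a)\<^sup>2 / \<alpha> + (norm b)\<^sup>2 / \<beta>"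
proof -
  have "(norm (\<beta> *\<^sub>R a - \<alpha> *\<^sub>R b))\<^sup>2 \<ge> 0" by simp
  then have "2 * (a \<bullet> b) * (\<alpha> * \<beta>) \<le> \<beta>\<^sup>2 * (a \<bullet> a) + \<alpha>\<^sup>2 * (b \<bullet> b)"
    by (simp only: power2_norm_eq_inner)
       (simp add: inner_diff_left inner_diff_right inner_commute power2_eq_square algebra_simps)
  then have "\<alpha> * \<beta> * ((a + b) \<bullet> (a + b)) \<le> (\<alpha> + \<beta>) * (\<beta> * (a \<bullet> a) + \<alpha> * (b \<bullet> b))"
    by (simp add: inner_add_left inner_add_right inner_commute power2_eq_square algebra_simps)
  then show ?thesis using assms
    by (simp add: power2_norm_eq_inner field_simps add_pos_pos)
qed

text \<open>The energy is the minimum of the right-hand side over \<open>v \<in> C\<close>, attained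
  at (s - 1) / s times the projection of \<open>y\<close>. For the inequality, the residual has
  nonpositive inner product with \<open>v\<close>, and s splits as 1 + (s - 1).\<close>

lemma cone_energy_le_primal:
  fixes y :: "'a::euclidean_space"
  assumes C: "closed_convex_cone C" and s: "s > 1" and v: "v \<in> C"
  shows "cone_energy C s y \<le> (norm (y - v))\<^sup>2 + (norm v)\<^sup>2 / (s - 1)"
proof -
  define p n where "p = closest_point C y" and "n = y - p"
  have n: "n \<bullet> p = 0" "n \<bullet> v \<le> 0"
    using closest_point_cone[OF C, where x = y] v by (auto simp: n_def p_def)
  have "(norm (y - v))\<^sup>2 = (norm (n + (p - v)))\<^sup>2" by (simp add: n_def)
  also have "\<dots> = (norm n)\<^sup>2 + 2 * (n \<bullet> (p - v)) + (norm (p - v))\<^sup>2"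
    by (simp only: power2_norm_eq_inner) (simp add: inner_add_left inner_add_right inner_commute)
  also have "\<dots> \<ge> (norm n)\<^sup>2 + (norm (p - v))\<^sup>2" using n by (simp add: inner_diff_right)
  finally have 1: "(norm n)\<^sup>2 + (norm (p - v))\<^sup>2 \<le> (norm (y - v))\<^sup>2" .
  have "(norm p)\<^sup>2 / s \<le> (norm (p - v))\<^sup>2 + (norm v)\<^sup>2 / (s - 1)"
    using norm_add_square_divide_le[of 1 "s - 1" "p - v" v] s by simp
  then show ?thesis using 1 by (simp add: cone_energy_def n_def p_def)
qed

text \<open>The counterpart for \<open>s < 1\<close>, where the coefficient 1 / (s - 1) of the other
  formula is negative. The minimum is now over the polar cone, attained at 1 - s times the residual
  of \<open>y\<close>, and 1 splits as s + (1 - s).\<close>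

lemma cone_energy_le_polar:
  fixes y :: "'a::euclidean_space"
  assumes C: "closed_convex_cone C" and s: "0 < s" "s < 1" and w: "w \<in> polar_cone C"
  shows "cone_energy C s y \<le> (norm (y - w))\<^sup>2 / s + (norm w)\<^sup>2 / (1 - s)"
proof -
  define p n where "p = closest_point C y" and "n = y - p"
  have n: "n \<bullet> p = 0" "p \<bullet> w \<le> 0"
    using closest_point_cone[OF C, where x = y] w by (auto simp: n_def p_def polar_cone_def inner_commute)
  have "(norm (y - w))\<^sup>2 = (norm (p + (n - w)))\<^sup>2" by (simp add: n_def algebra_simps)
  also have "\<dots> = (norm p)\<^sup>2 + 2 * (p \<bullet> (n - w)) + (norm (n - w))\<^sup>2"
    by (simp only: power2_norm_eq_inner) (simp add: inner_add_left inner_add_right inner_commute)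
  also have "\<dots> \<ge> (norm p)\<^sup>2 + (norm (n - w))\<^sup>2" using n by (simp add: inner_diff_right inner_commute)
  finally have "(norm p)\<^sup>2 / s + (norm (n - w))\<^sup>2 / s \<le> (norm (y - w))\<^sup>2 / s"
    using s by (simp add: divide_right_mono flip: add_divide_distrib)
  moreover have "(norm n)\<^sup>2 \<le> (norm (n - w))\<^sup>2 / s + (norm w)\<^sup>2 / (1 - s)"
    using norm_add_square_divide_le[of s "1 - s" "n - w" w] s by simp
  ultimately show ?thesis by (simp add: cone_energy_def n_def p_def)
qed

lemma cone_energy_one:
  assumes "closed_convex_cone C"
  shows "cone_energy C 1 x = (norm x)\<^sup>2"
  using norm_closest_point_cone[OF assms, of x] by (simp add: cone_energy_def)

text \<open>Jensen's inequality for the jointly convex function \<open>(s, x) \<mapsto> cone_energy C s x\<close>. Joint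
  convexity comes from writing it as a partial minimum of a jointly convex function: over \<open>C\<close> if
  \<open>s > 1\<close>, over the polar cone if \<open>s < 1\<close>.\<close>

lemma cone_energy_midpoint:
  fixes x y :: "'a::euclidean_space"
  assumes C: "closed_convex_cone C" and s: "s > 0"
  shows "cone_energy C ((1 + s) / 2) ((x + y) /\<^sub>R 2) \<le> ((norm x)\<^sup>2 + cone_energy C s y) / 2"
proof -
  define p n where "p = closest_point C y" and "n = y - p"
  have y: "y = p + n" by (simp add: n_def)
  have n: "n \<bullet> p = 0" "p \<in> C" "n \<in> polar_cone C"
    using closest_point_cone[OF C, where x = y] by (auto simp: n_def p_def polar_cone_def)
  have E: "cone_energy C s y = (p \<bullet> p) / s + n \<bullet> n"
    by (simp add: cone_energy_def p_def n_def power2_norm_eq_inner)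
  note D = closed_convex_coneD[OF C] and D' = closed_convex_coneD[OF closed_convex_cone_polar[of C]]
  consider "s = 1" | "s > 1" | "s < 1" by linarith
  then show ?thesis
  proof cases
    case 1
    have "(norm ((x + y) /\<^sub>R 2))\<^sup>2 \<le> ((norm x)\<^sup>2 + (norm y)\<^sup>2) / 2"
      using norm_add_square_divide_le[of 1 1 x y] by (simp add: power_divide)
    then show ?thesis using 1 by (simp add: cone_energy_one[OF C])
  next
    case 2
    \<comment> \<open>The minimiser of the variational formula at \<open>y\<close>. The minimiser
      belonging to \<open>x\<close> and parameter 1 is 0, so the average of the two, half of
      \<open>v\<close>, is the competitor at the midpoint.\<close>
    define v where "v = ((s - 1) / s) *\<^sub>R p"
    have yv: "y - v = n + (1 / s) *\<^sub>R p"
      using 2 by (simp add: v_def y diff_divide_distrib algebra_simps)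
    have "cone_energy C ((1 + s) / 2) ((x + y) /\<^sub>R 2) \<le>
        (norm ((x + y) /\<^sub>R 2 - (1 / 2) *\<^sub>R v))\<^sup>2 + (norm ((1 / 2) *\<^sub>R v))\<^sup>2 / ((1 + s) / 2 - 1)"
      using 2 n D by (intro cone_energy_le_primal[OF C]) (auto simp: v_def)
    also have "\<dots> = (norm (x + (y - v)))\<^sup>2 / 4 + (norm v)\<^sup>2 / (2 * (s - 1))"
    proof -
      have "(x + y) /\<^sub>R 2 - (1 / 2) *\<^sub>R v = (1 / 2) *\<^sub>R (x + (y - v))" by (simp add: algebra_simps)
      then have "(norm ((x + y) /\<^sub>R 2 - (1 / 2) *\<^sub>R v))\<^sup>2 = (norm (x + (y - v)))\<^sup>2 / 4"
        by (simp only: norm_scaleR) (simp add: power_mult_distrib power_divide)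
      moreover have "(norm ((1 / 2) *\<^sub>R v))\<^sup>2 = (norm v)\<^sup>2 / 4"
        by (simp add: power_divide)
      ultimately show ?thesis using 2 by (simp only:) (simp add: field_simps)
    qed
    also have "\<dots> \<le> ((norm x)\<^sup>2 + (norm (y - v))\<^sup>2) / 2 + (norm v)\<^sup>2 / (2 * (s - 1))"
      using norm_add_square_divide_le[of 1 1 x "y - v"] by simp
    also have "\<dots> = ((norm x)\<^sup>2 + ((norm (y - v))\<^sup>2 + (norm v)\<^sup>2 / (s - 1))) / 2"
      by (simp add: add_divide_distrib)
    also have "(norm (y - v))\<^sup>2 + (norm v)\<^sup>2 / (s - 1) = cone_energy C s y"
    proof -
      have "(norm (y - v))\<^sup>2 = n \<bullet> n + (p \<bullet> p) / s\<^sup>2"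
        unfolding yv using n(1) by (simp only: power2_norm_eq_inner)
          (simp add: inner_add_left inner_add_right inner_commute power2_eq_square)
      moreover have "(norm v)\<^sup>2 / (s - 1) = (s - 1) * (p \<bullet> p) / s\<^sup>2"
        using 2 by (simp add: v_def power_mult_distrib power_divide dot_square_norm power2_eq_square)
      moreover have "(p \<bullet> p) / s\<^sup>2 + (s - 1) * (p \<bullet> p) / s\<^sup>2 = (p \<bullet> p) / s"
        using 2 by (simp add: power2_eq_square field_simps)
      ultimately show ?thesis by (simp add: E)
    qed
    finally show ?thesis .
  next
    case 3
    \<comment> \<open>Again the minimiser at \<open>y\<close>, now in the polar cone; half of it is
      the competitor at the midpoint.\<close>
    define w where "w = (1 - s) *\<^sub>R n"
    have yw: "y - w = p + s *\<^sub>R n" by (simp add: w_def y algebra_simps)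
    have "cone_energy C ((1 + s) / 2) ((x + y) /\<^sub>R 2) \<le>
        (norm ((x + y) /\<^sub>R 2 - (1 / 2) *\<^sub>R w))\<^sup>2 / ((1 + s) / 2) + (norm ((1 / 2) *\<^sub>R w))\<^sup>2 / (1 - (1 + s) / 2)"
      using 3 s n D' by (intro cone_energy_le_polar[OF C]) (auto simp: w_def)
    also have "\<dots> = ((norm (x + (y - w)))\<^sup>2 / (1 + s) + (norm w)\<^sup>2 / (1 - s)) / 2"
    proof -
      have "(x + y) /\<^sub>R 2 - (1 / 2) *\<^sub>R w = (1 / 2) *\<^sub>R (x + (y - w))" by (simp add: algebra_simps)
      then have "(norm ((x + y) /\<^sub>R 2 - (1 / 2) *\<^sub>R w))\<^sup>2 = (norm (x + (y - w)))\<^sup>2 / 4"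
        by (simp only: norm_scaleR) (simp add: power_mult_distrib power_divide)
      moreover have "(norm ((1 / 2) *\<^sub>R w))\<^sup>2 = (norm w)\<^sup>2 / 4"
        by (simp add: power_divide)
      moreover have "1 - (1 + s) / 2 = (1 - s) / 2" by (simp add: field_simps)
      ultimately show ?thesis by (simp only: add_divide_distrib) (simp add: mult.commute)
    qed
    \<comment> \<open>The weights 1 and \<open>s\<close> are unequal because the parameter also
      divides the first term here; plain convexity of the squared norm sufficed for
      \<open>s > 1\<close>.\<close>
    also have "\<dots> \<le> ((norm x)\<^sup>2 + ((norm (y - w))\<^sup>2 / s + (norm w)\<^sup>2 / (1 - s))) / 2"
      using norm_add_square_divide_le[of 1 s x "y - w"] s by (intro divide_right_mono) auto
    also have "(norm (y - w))\<^sup>2 / s + (norm w)\<^sup>2 / (1 - s) = cone_energy C s y"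
    proof -
      have "(norm (y - w))\<^sup>2 = p \<bullet> p + s\<^sup>2 * (n \<bullet> n)"
        unfolding yw using n(1) by (simp only: power2_norm_eq_inner)
          (simp add: inner_add_left inner_add_right inner_commute power2_eq_square)
      moreover have "(norm w)\<^sup>2 / (1 - s) = (1 - s) * (n \<bullet> n)"
        using 3 by (simp add: w_def power_mult_distrib dot_square_norm power2_eq_square)
      moreover have "s\<^sup>2 * (n \<bullet> n) / s + (1 - s) * (n \<bullet> n) = n \<bullet> n"
        using s by (simp add: power2_eq_square field_simps)
      ultimately show ?thesis by (simp add: E add_divide_distrib)
    qed
    finally show ?thesis .
  qed
qed

subsection \<open>The Gaussian functional of a cone\<close>

definition std_gaussian_density :: "'a::euclidean_space \<Rightarrow> real" where
  "std_gaussian_density x = (1 / sqrt (2 * pi)) ^ DIM('a) * exp (- (norm x)\<^sup>2 / 2)"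

lemma prod_std_normal_density:
  fixes x :: "'a::euclidean_space"
  shows "(\<Prod>b\<in>Basis. std_normal_density (x \<bullet> b)) = std_gaussian_density x"
proof -
  have "(\<Sum>b\<in>Basis. - (x \<bullet> b)\<^sup>2 / 2) = - (norm x)\<^sup>2 / 2"
    by (simp add: norm_eq_sqrt_inner euclidean_inner[of x x] power2_eq_square sum_negf sum_divide_distrib sum_nonneg)
  then show ?thesis
    by (simp add: std_normal_density_def std_gaussian_density_def prod.distrib power_one_over prod_dividef
        flip: exp_sum)
qed

lemma std_gaussian_eq: "std_gaussian = density lborel (\<lambda>x. ennreal (std_gaussian_density x))"
  by (simp add: std_gaussian_def prod_std_normal_density)

lemma measurable_std_gaussian_density [measurable]:
  "std_gaussian_density \<in> borel_measurable borel"
  unfolding std_gaussian_density_def[abs_def] by measurable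

lemma nn_integral_std_gaussian_density:
  "(\<integral>\<^sup>+x. ennreal (std_gaussian_density (x :: 'a::euclidean_space)) \<partial>lborel) = 1"
proof -
  have "(\<integral>\<^sup>+x. ennreal (std_normal_density x) \<partial>lborel) = 1"
    using prob_space.emeasure_space_1[OF prob_space_normal_density[of 1 0]]
    by (simp add: emeasure_density)
  moreover have "(\<integral>\<^sup>+x. (\<Prod>b\<in>Basis. ennreal (std_normal_density ((x::'a) \<bullet> b))) \<partial>lborel) =
      (\<Prod>b\<in>(Basis::'a set). \<integral>\<^sup>+x. ennreal (std_normal_density x) \<partial>lborel)"
    by (rule nn_integral_lborel_prod) auto
  ultimately show ?thesis
    by (simp add: prod_ennreal prod_std_normal_density)
qed

lemma nn_integral_std_gaussian_density_scaled:
  assumes r: "r > 0"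
  shows "(\<integral>\<^sup>+x. ennreal (std_gaussian_density (r *\<^sub>R x :: 'a::euclidean_space)) \<partial>lborel) < \<infinity>"
proof -
  have "(\<integral>\<^sup>+x. ennreal (std_gaussian_density (x::'a)) \<partial>lborel) =
      (\<integral>\<^sup>+x. ennreal (std_gaussian_density (x::'a)) \<partial>density (distr lborel borel (\<lambda>x. 0 + r *\<^sub>R x)) (\<lambda>_. \<bar>r\<bar>^DIM('a)))"
    using lborel_affine[of r "0::'a"] r by simp
  also have "\<dots> = ennreal (r ^ DIM('a)) * (\<integral>\<^sup>+x. ennreal (std_gaussian_density (r *\<^sub>R x :: 'a)) \<partial>lborel)"
    using r by (simp add: nn_integral_density nn_integral_distr nn_integral_cmult)
  finally have *: "ennreal (r ^ DIM('a)) * (\<integral>\<^sup>+x. ennreal (std_gaussian_density (r *\<^sub>R x :: 'a)) \<partial>lborel) = 1"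
    by (simp add: nn_integral_std_gaussian_density)
  show ?thesis
  proof (rule ccontr)
    assume "\<not> ?thesis"
    then have "(\<integral>\<^sup>+x. ennreal (std_gaussian_density (r *\<^sub>R x :: 'a)) \<partial>lborel) = top"
      by (metis infinity_ennreal_def less_top)
    then show False using * r by (simp add: ennreal_mult_top)
  qed
qed

lemma continuous_cone_energy:
  assumes C: "closed_convex_cone C"
  shows "continuous_on S (cone_energy C s)"
  unfolding cone_energy_def[abs_def] divide_inverse
  by (intro continuous_intros continuous_closest_point_cone C)

text \<open>The constant is the one that normalises \<open>s = 1\<close>, for every
  \<open>s\<close>. The total mass therefore varies with \<open>s\<close>, and this variation
  carries the intrinsic volumes.\<close>

definition cone_gauss_density :: "'a::euclidean_space set \<Rightarrow> real \<Rightarrow> 'a \<Rightarrow> real" where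
  "cone_gauss_density C s x = (1 / sqrt (2 * pi)) ^ DIM('a) * exp (- cone_energy C s x / 2)"

lemma measurable_cone_gauss_density:
  assumes C: "closed_convex_cone C"
  shows "cone_gauss_density C s \<in> borel_measurable borel"
  unfolding cone_gauss_density_def[abs_def]
  by (intro borel_measurable_continuous_onI continuous_intros continuous_cone_energy C) auto

lemma cone_gauss_density_pos: "cone_gauss_density C s x > 0"
  by (simp add: cone_gauss_density_def)

lemma cone_gauss_density_one:
  assumes "closed_convex_cone C"
  shows "cone_gauss_density C 1 x = std_gaussian_density x"
  by (simp add: cone_gauss_density_def std_gaussian_density_def cone_energy_one[OF assms])

definition cone_gauss :: "'a::euclidean_space set \<Rightarrow> real \<Rightarrow> ennreal" where
  "cone_gauss C s = (\<integral>\<^sup>+x. ennreal (cone_gauss_density C s x) \<partial>lborel)"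

lemma cone_gauss_one:
  assumes "closed_convex_cone C"
  shows "cone_gauss C 1 = 1"
  by (simp add: cone_gauss_def cone_gauss_density_one[OF assms] nn_integral_std_gaussian_density)

text \<open>The bound does not depend on the cone, so it serves as the dominating function when
  cones converge. Raising both denominators of the energy to \<open>max 1 s\<close> leaves a
  multiple of the squared norm of \<open>x\<close>.\<close>

lemma cone_gauss_density_le:
  fixes x :: "'a::euclidean_space"
  assumes C: "closed_convex_cone C" and s: "s > 0"
  shows "cone_gauss_density C s x \<le> std_gaussian_density ((1 / sqrt (max 1 s)) *\<^sub>R x)"
proof -
  define m where "m = max 1 s"
  have m: "m > 0" "s \<le> m" "1 \<le> m" using s by (auto simp: m_def)
  have "(norm x)\<^sup>2 / m = (norm (closest_point C x))\<^sup>2 / m + (norm (x - closest_point C x))\<^sup>2 / m"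
    using norm_closest_point_cone[OF C, of x] by (simp add: add_divide_distrib)
  also have "\<dots> \<le> cone_energy C s x"
    unfolding cone_energy_def using m s
    by (intro add_mono divide_left_mono) (auto simp: divide_le_eq mult_le_cancel_left1)
  finally have "(norm x)\<^sup>2 / m \<le> cone_energy C s x" .
  moreover have "(norm ((1 / sqrt m) *\<^sub>R x))\<^sup>2 = (norm x)\<^sup>2 / m"
    using m by (simp add: power_divide)
  ultimately show ?thesis
    unfolding cone_gauss_density_def std_gaussian_density_def m_def[symmetric]
    by (intro mult_left_mono) auto
qed

text \<open>Prekopa-Leindler for the weights with parameters 1, \<open>s\<close> and their midpoint.
  The factor \<open>cone_gauss C 1\<close> equals 1 and disappears.\<close>

lemma cone_gauss_midpoint:
  fixes C :: "'a::euclidean_space set"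
  assumes C: "closed_convex_cone C" and s: "s > 0"
  shows "cone_gauss C s \<le> (cone_gauss C ((1 + s) / 2))\<^sup>2"
proof -
  note [measurable] = measurable_cone_gauss_density[OF C]
  have "cone_gauss C 1 * cone_gauss C s \<le> (cone_gauss C ((1 + s) / 2))\<^sup>2"
    unfolding cone_gauss_def
  proof (rule Prekopa_Leindler)
    fix x y :: 'a
    define K where "K = (1 / sqrt (2 * pi)) ^ DIM('a)"
    have K: "K > 0" by (simp add: K_def)
    have "exp (- cone_energy C 1 x / 2) * exp (- cone_energy C s y / 2) \<le>
        (exp (- cone_energy C ((1 + s) / 2) ((x + y) /\<^sub>R 2) / 2))\<^sup>2"
      using cone_energy_midpoint[OF C s, of x y]
      by (simp add: cone_energy_one[OF C] flip: exp_add exp_double)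
    then have "K\<^sup>2 * (exp (- cone_energy C 1 x / 2) * exp (- cone_energy C s y / 2)) \<le>
        K\<^sup>2 * (exp (- cone_energy C ((1 + s) / 2) ((x + y) /\<^sub>R 2) / 2))\<^sup>2"
      by (rule mult_left_mono) simp
    then have "cone_gauss_density C 1 x * cone_gauss_density C s y
        \<le> (cone_gauss_density C ((1 + s) / 2) ((x + y) /\<^sub>R 2))\<^sup>2"
      unfolding cone_gauss_density_def K_def[symmetric] power_mult_distrib by (simp add: power2_eq_square mult_ac)
    then show "ennreal (cone_gauss_density C 1 x) * ennreal (cone_gauss_density C s y)
        \<le> (ennreal (cone_gauss_density C ((1 + s) / 2) ((x + y) /\<^sub>R 2)))\<^sup>2"
      using cone_gauss_density_pos[of C]
      by (simp add: ennreal_mult[symmetric] ennreal_power less_imp_le ennreal_leI)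
  qed measurable
  then show ?thesis by (simp add: cone_gauss_one[OF C])
qed

text \<open>Passing to the polar cone exchanges projection and residual. The substitution of
  \<open>z *\<^sub>R x\<close> moves the parameter back to the component in \<open>C\<close>, at the
  price of the Jacobian. This is the duality of intrinsic volumes on the level of generating
  functions.\<close>

lemma cone_gauss_polar:
  fixes C :: "'a::euclidean_space set"
  assumes C: "closed_convex_cone C" and z: "z > 0"
  shows "cone_gauss (polar_cone C) (z\<^sup>2) = ennreal (z ^ DIM('a)) * cone_gauss C (1 / z\<^sup>2)"
proof -
  note [measurable] = measurable_cone_gauss_density[OF closed_convex_cone_polar[of C]]
  have "cone_gauss (polar_cone C) (z\<^sup>2) =
      (\<integral>\<^sup>+x. ennreal (cone_gauss_density (polar_cone C) (z\<^sup>2) x)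
        \<partial>density (distr lborel borel (\<lambda>x. 0 + z *\<^sub>R x)) (\<lambda>_. \<bar>z\<bar>^DIM('a)))"
    unfolding cone_gauss_def using lborel_affine[of z "0::'a"] z by simp
  also have "\<dots> = ennreal (z ^ DIM('a)) *
      (\<integral>\<^sup>+x. ennreal (cone_gauss_density (polar_cone C) (z\<^sup>2) (z *\<^sub>R x)) \<partial>lborel)"
    using z by (simp add: nn_integral_density nn_integral_distr nn_integral_cmult)
  also have "(\<lambda>x. cone_gauss_density (polar_cone C) (z\<^sup>2) (z *\<^sub>R x)) = cone_gauss_density C (1 / z\<^sup>2)"
  proof
    fix x
    have "cone_energy (polar_cone C) (z\<^sup>2) (z *\<^sub>R x) = cone_energy C (1 / z\<^sup>2) x"
      using z by (simp add: cone_energy_def closest_point_polar_cone[OF C] closest_point_cone_scaleR[OF C]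
          power_mult_distrib flip: scaleR_diff_right)
    then show "cone_gauss_density (polar_cone C) (z\<^sup>2) (z *\<^sub>R x) = cone_gauss_density C (1 / z\<^sup>2) x"
      by (simp add: cone_gauss_density_def)
  qed
  finally show ?thesis by (simp add: cone_gauss_def)
qed

subsection \<open>The Steiner formula for polyhedral cones\<close>

lemma polyhedral_cone_imp_closed_convex_cone:
  fixes C :: "'a::euclidean_space set"
  assumes "polyhedral_cone C"
  shows "closed_convex_cone C"
proof -
  obtain U where C: "C = {x. \<forall>u\<in>U. 0 \<le> u \<bullet> x}" using assms by (auto simp: polyhedral_cone_def)
  then have eq: "C = (\<Inter>u\<in>U. {x. u \<bullet> x \<ge> 0})" by auto
  have "closed C" unfolding eq by (intro closed_INT ballI closed_halfspace_ge)
  then show ?thesis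
    unfolding closed_convex_cone_def convex_cone_iff by (auto simp: C inner_add_right)
qed

lemma polyhedral_cone_imp_polyhedron:
  fixes C :: "'a::euclidean_space set"
  assumes "polyhedral_cone C"
  shows "polyhedron C"
proof -
  obtain U where U: "finite U" and C: "C = {x. \<forall>u\<in>U. 0 \<le> u \<bullet> x}"
    using assms by (auto simp: polyhedral_cone_def)
  then have eq: "C = \<Inter>((\<lambda>u. {x. u \<bullet> x \<ge> 0}) ` U)" by auto
  show ?thesis unfolding eq using U
    by (intro polyhedron_Inter) (auto simp: polyhedron_halfspace_ge)
qed

text \<open>A vector of the polar cone is nonpositive on \<open>C\<close> and zero at the apex, so
  the supremum in the definition is 0.\<close>

lemma cone_faces_eq:
  fixes C :: "'a::euclidean_space set"
  assumes C: "closed_convex_cone C"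
  shows "cone_faces C = {{x \<in> C. u \<bullet> x = 0} | u. u \<in> polar_cone C}"
proof -
  have "(SUP y\<in>C. u \<bullet> y) = 0" if "u \<in> polar_cone C" for u
  proof (rule antisym)
    show "(SUP y\<in>C. u \<bullet> y) \<le> 0"
      using that closed_convex_coneD[OF C] by (intro cSUP_least) (auto simp: polar_cone_def)
    have "u \<bullet> 0 \<le> (SUP y\<in>C. u \<bullet> y)"
      using that closed_convex_coneD[OF C]
      by (intro cSUP_upper) (auto simp: polar_cone_def bdd_above_def)
    then show "0 \<le> (SUP y\<in>C. u \<bullet> y)" by simp
  qed
  then have "{x \<in> C. u \<bullet> x = (SUP y\<in>C. u \<bullet> y)} = {x \<in> C. u \<bullet> x = 0}" if "u \<in> polar_cone C" for u
    using that by simp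
  then show ?thesis unfolding cone_faces_def by blast
qed

lemma cone_faces_face_of:
  assumes C: "closed_convex_cone C" and F: "F \<in> cone_faces C"
  shows "F face_of C"
proof -
  obtain u where u: "u \<in> polar_cone C" "F = {x \<in> C. u \<bullet> x = 0}"
    using F by (auto simp: cone_faces_eq[OF C])
  then have "(C \<inter> {x. u \<bullet> x = 0}) face_of C"
    using closed_convex_coneD[OF C]
    by (intro face_of_Int_supporting_hyperplane_le) (auto simp: polar_cone_def)
  then show ?thesis using u by (simp add: Int_def)
qed

lemma closed_convex_cone_face:
  assumes C: "closed_convex_cone C" and F: "F \<in> cone_faces C"
  shows "closed_convex_cone F"
proof -
  obtain u where u: "u \<in> polar_cone C" "F = {x \<in> C. u \<bullet> x = 0}"
    using F by (auto simp: cone_faces_eq[OF C])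
  have "closed F"
    using closed_convex_coneD(1)[OF C] closed_hyperplane[of u 0] closed_Int
    unfolding u(2) by (auto simp: Collect_conj_eq)
  then show ?thesis
    unfolding closed_convex_cone_def convex_cone_iff
    using closed_convex_coneD[OF C] by (auto simp: u(2) inner_add_right)
qed

lemma finite_cone_faces:
  assumes "polyhedral_cone C"
  shows "finite (cone_faces C)"
  using finite_subset[OF _ finite_polyhedron_faces[OF polyhedral_cone_imp_polyhedron[OF assms]]]
    cone_faces_face_of[OF polyhedral_cone_imp_closed_convex_cone[OF assms]] by auto

text \<open>The face is cut out by the constraints active at \<open>p\<close>. The inactive ones
  hold strictly at \<open>p\<close>, hence on an open neighbourhood, and so do not restrict the face
  near \<open>p\<close>.\<close>

lemma rel_interior_cone_faces_cover:
  fixes C :: "'a::euclidean_space set"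
  assumes C: "polyhedral_cone C" and p: "p \<in> C"
  obtains F where "F \<in> cone_faces C" "p \<in> rel_interior F"
proof -
  obtain U where U: "finite U" and eq: "C = {x. \<forall>u\<in>U. 0 \<le> u \<bullet> x}"
    using C by (auto simp: polyhedral_cone_def)
  define Z where "Z = {u \<in> U. u \<bullet> p = 0}"
  \<comment> \<open>On \<open>C\<close> the active constraints are nonnegative, so their sum
    vanishes only where each of them does; a single vector thus exposes the whole face.\<close>
  define w where "w = - (\<Sum>u\<in>Z. u)"
  have finZ: "finite Z" using U by (simp add: Z_def)
  define F where "F = {x \<in> C. w \<bullet> x = 0}"
  have w: "w \<in> polar_cone C"
    unfolding w_def polar_cone_def
    by (auto simp: inner_sum_left Z_def eq intro!: sum_nonneg)
  have FZ: "x \<in> F \<longleftrightarrow> x \<in> C \<and> (\<forall>u\<in>Z. u \<bullet> x = 0)" for x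
  proof -
    have "w \<bullet> x = 0 \<longleftrightarrow> (\<Sum>u\<in>Z. u \<bullet> x) = 0" by (simp add: w_def inner_sum_left)
    moreover have "x \<in> C \<Longrightarrow> (\<Sum>u\<in>Z. u \<bullet> x) = 0 \<longleftrightarrow> (\<forall>u\<in>Z. u \<bullet> x = 0)"
      using finZ by (intro sum_nonneg_eq_0_iff) (auto simp: Z_def eq)
    ultimately show ?thesis by (auto simp: F_def)
  qed
  define T where "T = (\<Inter>u\<in>U - Z. {x. u \<bullet> x > 0})"
  have "open T" unfolding T_def using U by (intro open_INT ballI open_halfspace_gt) auto
  moreover have "p \<in> T" using p by (force simp: T_def eq Z_def)
  moreover have "p \<in> F" using p by (auto simp: FZ Z_def)
  moreover have "T \<inter> affine hull F \<subseteq> F"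
  proof
    fix x assume x: "x \<in> T \<inter> affine hull F"
    have "affine {x. \<forall>u\<in>Z. u \<bullet> x = 0}"
      by (auto simp: affine_def inner_add_right)
    then have "affine hull F \<subseteq> {x. \<forall>u\<in>Z. u \<bullet> x = 0}"
      by (intro hull_minimal) (auto simp: FZ)
    then have z: "\<forall>u\<in>Z. u \<bullet> x = 0" using x by auto
    have "0 \<le> u \<bullet> x" if "u \<in> U" for u
      using x z that by (cases "u \<in> Z") (auto simp: T_def less_imp_le)
    then have "x \<in> C" by (simp add: eq)
    then show "x \<in> F" using z by (simp add: FZ)
  qed
  ultimately have "p \<in> rel_interior F" by (auto simp: mem_rel_interior)
  moreover have "F \<in> cone_faces C"
    unfolding cone_faces_eq[OF polyhedral_cone_imp_closed_convex_cone[OF C]] F_def using w by blast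
  ultimately show ?thesis using that by blast
qed

section \<open>Points whose projection falls in a given face\<close>

definition face_region :: "'a::euclidean_space set \<Rightarrow> 'a set \<Rightarrow> 'a set" where
  "face_region C F = {x. closest_point C x \<in> rel_interior F}"

lemma measurable_face_region:
  assumes C: "closed_convex_cone C"
  shows "face_region C F \<in> sets borel"
proof -
  have [measurable]: "closest_point C \<in> borel_measurable borel"
    by (intro borel_measurable_continuous_onI continuous_closest_point_cone C)
  obtain T where T: "open T" "rel_interior F = affine hull F \<inter> T"
    using openin_rel_interior[of F] unfolding openin_open by blast
  then have [measurable]: "rel_interior F \<in> sets borel"
    using closed_affine_hull[of F] by auto
  show ?thesis unfolding face_region_def by measurable
qed

lemma disjoint_face_region:
  assumes C: "closed_convex_cone C"
  shows "disjoint_family_on (face_region C) (cone_faces C)"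
proof (unfold disjoint_family_on_def, intro ballI impI)
  fix F G assume "F \<in> cone_faces C" "G \<in> cone_faces C" "F \<noteq> G"
  then have "rel_interior F \<inter> rel_interior G = {}"
    using face_of_eq cone_faces_face_of[OF C] by metis
  then show "face_region C F \<inter> face_region C G = {}" by (auto simp: face_region_def)
qed

lemma face_region_cover:
  assumes C: "polyhedral_cone C"
  shows "(\<Union>F\<in>cone_faces C. face_region C F) = UNIV"
proof -
  have "\<exists>F\<in>cone_faces C. x \<in> face_region C F" for x
    using rel_interior_cone_faces_cover[OF C
        closest_point_cone_mem[OF polyhedral_cone_imp_closed_convex_cone[OF C], of x]]
    by (auto simp: face_region_def)
  then show ?thesis by auto
qed

lemma sum_indicator_face_region:
  assumes C: "polyhedral_cone C"
  shows "(\<Sum>F\<in>cone_faces C. indicator (face_region C F) x) = (1 :: ennreal)"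
  using indicator_UN_disjoint[OF finite_cone_faces[OF C]
      disjoint_face_region[OF polyhedral_cone_imp_closed_convex_cone[OF C]], of x]
  by (simp add: face_region_cover[OF C])

text \<open>The residual of \<open>x\<close> exposes a face of \<open>C\<close> that contains the
  projection. Since the projection is a relative interior point of \<open>F\<close>, that face
  contains all of \<open>F\<close>, so the residual is orthogonal to \<open>F\<close> and to its
  span.\<close>

lemma face_region_orthogonal_span:
  assumes C: "closed_convex_cone C" and F: "F \<in> cone_faces C" and x: "x \<in> face_region C F"
    and y: "y \<in> span F"
  shows "(x - closest_point C x) \<bullet> y = 0"
proof -
  define p n where "p = closest_point C x" and "n = x - p"
  have n: "n \<bullet> p = 0" "\<And>y. y \<in> C \<Longrightarrow> n \<bullet> y \<le> 0" "p \<in> C"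
    using closest_point_cone[OF C, where x = x] by (auto simp: n_def p_def)
  have p: "p \<in> rel_interior F" using x by (simp add: face_region_def p_def)
  have "(C \<inter> {y. n \<bullet> y = 0}) face_of C"
    using closed_convex_coneD[OF C] n
    by (intro face_of_Int_supporting_hyperplane_le) auto
  then have "F \<subseteq> C \<inter> {y. n \<bullet> y = 0}"
    by (rule subset_of_face_of)
       (use face_of_imp_subset[OF cone_faces_face_of[OF C F]] n p in auto)
  then have "span F \<subseteq> {y. n \<bullet> y = 0}"
    by (intro span_minimal) (auto simp: subspace_hyperplane)
  then show ?thesis using y by (auto simp: n_def p_def)
qed

text \<open>The residual is orthogonal to the span of \<open>F\<close> and the projection lies in
  it, so the stretch multiplies the projection by \<open>z\<close> and fixes the residual. The new
  pair still satisfies the criterion for projections.\<close>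

lemma stretch_face_region:
  fixes C :: "'a::euclidean_space set"
  assumes C: "closed_convex_cone C" and F: "F \<in> cone_faces C" and x: "x \<in> face_region C F"
    and B: "finite B" "pairwise orthogonal B" "\<And>e. e \<in> B \<Longrightarrow> norm e = 1" "span B = span F"
    and z: "z > 0"
  shows closest_point_stretch: "closest_point C (stretch z B x) = z *\<^sub>R closest_point C x"
    and stretch_diff_closest_point:
      "stretch z B x - closest_point C (stretch z B x) = x - closest_point C x"
    and stretch_mem_face_region: "stretch z B x \<in> face_region C F"
proof -
  define p n where "p = closest_point C x" and "n = x - p"
  have n: "n \<bullet> p = 0" "\<And>y. y \<in> C \<Longrightarrow> n \<bullet> y \<le> 0" "p \<in> C"
    using closest_point_cone[OF C, where x = x] by (auto simp: n_def p_def)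
  have p: "p \<in> rel_interior F" using x by (simp add: face_region_def p_def)
  have pF: "p \<in> F" using p rel_interior_subset by blast
  have orth: "n \<bullet> y = 0" if "y \<in> span F" for y
    using face_region_orthogonal_span[OF C F x that] by (simp add: n_def p_def)
  have "x = p + n" by (simp add: n_def)
  then have "stretch z B x = stretch z B p + stretch z B n"
    by (simp add: linear_add[OF linear_stretch])
  also have "stretch z B n = n"
    by (rule stretch_orthogonal) (use B(4) orth span_base in blast)
  also have "stretch z B p = z *\<^sub>R p"
    by (rule stretch_span) (use B pF span_base in auto)
  finally have eq: "stretch z B x = z *\<^sub>R p + n" .
  show c: "closest_point C (stretch z B x) = z *\<^sub>R closest_point C x"
    unfolding eq p_def[symmetric]
    by (rule closest_point_cone_eqI[OF C])
       (use n z closed_convex_coneD(6)[OF C] in auto)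
  then show "stretch z B x - closest_point C (stretch z B x) = x - closest_point C x"
    by (simp add: eq p_def[symmetric] n_def)
  have zF: "(*\<^sub>R) z ` F = F"
  proof (intro subset_antisym subsetI)
    note cF = closed_convex_coneD(6)[OF closed_convex_cone_face[OF C F]]
    show "y \<in> F" if "y \<in> (*\<^sub>R) z ` F" for y using that z cF by auto
    show "y \<in> (*\<^sub>R) z ` F" if "y \<in> F" for y
      using z cF[OF that, of "1 / z"] by (intro image_eqI[of _ _ "(1 / z) *\<^sub>R y"]) auto
  qed
  have "z *\<^sub>R p \<in> rel_interior F"
    using rel_interior_scaleR[of z F] z p zF by auto
  then show "stretch z B x \<in> face_region C F" by (simp add: face_region_def c p_def)
qed

text \<open>The stretch along the span of \<open>F\<close> maps the region onto itself and cancels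
  the division by \<open>z\<^sup>2\<close> in the energy, so the weight becomes the standard
  Gaussian. What is left is the Jacobian, one factor \<open>z\<close> for each dimension of the
  face.\<close>

lemma nn_integral_face_region:
  fixes C :: "'a::euclidean_space set"
  assumes C: "closed_convex_cone C" and F: "F \<in> cone_faces C" and z: "z > 0"
  shows "(\<integral>\<^sup>+x. ennreal (cone_gauss_density C (z\<^sup>2) x) * indicator (face_region C F) x \<partial>lborel) =
    ennreal (z ^ dim F) * emeasure std_gaussian (face_region C F)"
proof -
  note [measurable] = measurable_cone_gauss_density[OF C] measurable_face_region[OF C]
  obtain B where B: "pairwise orthogonal B" "\<And>e. e \<in> B \<Longrightarrow> norm e = 1" "independent B"
    "card B = dim (span F)" "span B = span F"
    by (metis orthonormal_basis_subspace subspace_span)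
  then have fin: "finite B" by (simp add: independent_imp_finite)
  note st = stretch_face_region[OF C F _ fin B(1,2,5)]
  have ind: "stretch z B x \<in> face_region C F \<longleftrightarrow> x \<in> face_region C F" for x
    using st(3)[of x z] st(3)[of "stretch z B x" "1 / z"] z stretch_inverse[OF fin B(1,2) z]
    by auto
  have dens: "cone_gauss_density C (z\<^sup>2) (stretch z B x) = std_gaussian_density x"
    if "x \<in> face_region C F" for x
  proof -
    have "cone_energy C (z\<^sup>2) (stretch z B x) = (norm x)\<^sup>2"
      unfolding cone_energy_def
      unfolding st(2)[OF that _ z, simplified] unfolding st(1)[OF that _ z, simplified]
      using z norm_closest_point_cone[OF C, of x] by (simp add: power_mult_distrib)
    then show ?thesis by (simp add: cone_gauss_density_def std_gaussian_density_def)
  qed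
  have "(\<integral>\<^sup>+x. ennreal (cone_gauss_density C (z\<^sup>2) x) * indicator (face_region C F) x \<partial>lborel) =
     ennreal (z ^ card B) * (\<integral>\<^sup>+x. ennreal (cone_gauss_density C (z\<^sup>2) (stretch z B x)) *
       indicator (face_region C F) (stretch z B x) \<partial>lborel)"
    by (rule nn_integral_stretch[symmetric]) (use z fin B in auto)
  also have "(\<integral>\<^sup>+x. ennreal (cone_gauss_density C (z\<^sup>2) (stretch z B x)) *
       indicator (face_region C F) (stretch z B x) \<partial>lborel) =
     (\<integral>\<^sup>+x. ennreal (std_gaussian_density x) * indicator (face_region C F) x \<partial>lborel)"
    by (rule nn_integral_cong) (auto simp: indicator_def ind dens)
  also have "\<dots> = emeasure std_gaussian (face_region C F)"
    unfolding std_gaussian_eq by (rule emeasure_density[symmetric]) auto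
  also have "card B = dim F" using B by simp
  finally show ?thesis .
qed

lemma prob_space_std_gaussian: "prob_space std_gaussian"
  by (rule prob_spaceI) (simp add: std_gaussian_eq emeasure_density nn_integral_std_gaussian_density)

lemma polyhedral_intrinsic_volume_eq_sum:
  fixes C :: "'a::euclidean_space set"
  assumes C: "polyhedral_cone C"
  shows "polyhedral_intrinsic_volume C k =
    (\<Sum>F\<in>{F\<in>cone_faces C. dim F = k}. measure std_gaussian (face_region C F))"
proof -
  interpret prob_space "std_gaussian :: 'a measure" by (rule prob_space_std_gaussian)
  note C' = polyhedral_cone_imp_closed_convex_cone[OF C]
  have "{g. \<exists>F\<in>cone_faces C. dim F = k \<and> closest_point C g \<in> rel_interior F} =
      (\<Union>F\<in>{F\<in>cone_faces C. dim F = k}. face_region C F)"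
    by (auto simp: face_region_def)
  then show ?thesis
    unfolding polyhedral_intrinsic_volume_def
    using disjoint_face_region[OF C'] measurable_face_region[OF C'] finite_cone_faces[OF C]
    by (subst finite_measure_finite_Union[symmetric])
      (auto simp: disjoint_family_on_def std_gaussian_eq)
qed

text \<open>The master Steiner formula, tested on the Gaussian weight that defines \<open>cone_gauss\<close>.\<close>

lemma polyhedral_Steiner:
  fixes C :: "'a::euclidean_space set"
  assumes C: "polyhedral_cone C" and z: "z > 0"
  shows "cone_gauss C (z\<^sup>2) = ennreal (\<Sum>k\<le>DIM('a). polyhedral_intrinsic_volume C k * z ^ k)"
proof -
  interpret prob_space "std_gaussian :: 'a measure" by (rule prob_space_std_gaussian)
  note C' = polyhedral_cone_imp_closed_convex_cone[OF C]
  note [measurable] = measurable_cone_gauss_density[OF C'] measurable_face_region[OF C']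
  note fin = finite_cone_faces[OF C]
  have "cone_gauss C (z\<^sup>2) = (\<integral>\<^sup>+x. (\<Sum>F\<in>cone_faces C.
      ennreal (cone_gauss_density C (z\<^sup>2) x) * indicator (face_region C F) x) \<partial>lborel)"
    unfolding cone_gauss_def
    by (simp add: sum_indicator_face_region[OF C] flip: sum_distrib_left)
  also have "\<dots> = (\<Sum>F\<in>cone_faces C. ennreal (z ^ dim F) * emeasure std_gaussian (face_region C F))"
    using nn_integral_face_region[OF C' _ z] by (subst nn_integral_sum) auto
  also have "\<dots> = ennreal (\<Sum>F\<in>cone_faces C. z ^ dim F * measure std_gaussian (face_region C F))"
    using z by (simp add: emeasure_eq_measure ennreal_mult[symmetric] sum_ennreal)
  also have "(\<Sum>F\<in>cone_faces C. z ^ dim F * measure std_gaussian (face_region C F)) =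
      (\<Sum>k\<le>DIM('a). \<Sum>F\<in>{F\<in>cone_faces C. dim F = k}. z ^ dim F * measure std_gaussian (face_region C F))"
    using dim_subset_UNIV by (intro sum.group[symmetric] fin) auto
  also have "\<dots> = (\<Sum>k\<le>DIM('a). polyhedral_intrinsic_volume C k * z ^ k)"
    by (rule sum.cong) (auto simp: polyhedral_intrinsic_volume_eq_sum[OF C] sum_distrib_left mult.commute)
  finally show ?thesis .
qed

subsection \<open>Approximation by polyhedral cones\<close>

lemma inner_divide_norms_bounds:
  fixes x y :: "'a::real_inner"
  shows "- 1 \<le> x \<bullet> y / (norm x * norm y)" "x \<bullet> y / (norm x * norm y) \<le> 1"
proof -
  have "\<bar>x \<bullet> y / (norm x * norm y)\<bar> \<le> 1"
    using Cauchy_Schwarz_ineq2[of x y] by (auto simp: abs_mult divide_le_eq_1)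
  then show "- 1 \<le> x \<bullet> y / (norm x * norm y)" "x \<bullet> y / (norm x * norm y) \<le> 1"
    by linarith+
qed

lemma dist_s_le_pi: "dist_s x y \<le> pi"
  using inner_divide_norms_bounds[of x y] by (auto simp: dist_s_def intro!: arccos_ubound)

lemma conic_hausdorff_set_nonempty:
  assumes "C \<noteq> {}" "D \<noteq> {}"
  shows "{\<alpha>. 0 \<le> \<alpha> \<and> D \<subseteq> angular_expansion C \<alpha> \<and> C \<subseteq> angular_expansion D \<alpha>} \<noteq> {}"
proof -
  have "pi \<in> {\<alpha>. 0 \<le> \<alpha> \<and> D \<subseteq> angular_expansion C \<alpha> \<and> C \<subseteq> angular_expansion D \<alpha>}"
    using assms dist_s_le_pi by (auto simp: angular_expansion_def)
  then show ?thesis by blast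
qed

lemma conic_hausdorff_nonneg:
  assumes "C \<noteq> {}" "D \<noteq> {}"
  shows "0 \<le> conic_hausdorff C D"
  unfolding conic_hausdorff_def
  using conic_hausdorff_set_nonempty[OF assms] by (intro cInf_greatest) auto

lemma conic_hausdorff_le:
  assumes "0 \<le> \<alpha>" "D \<subseteq> angular_expansion C \<alpha>" "C \<subseteq> angular_expansion D \<alpha>"
  shows "conic_hausdorff C D \<le> \<alpha>"
  unfolding conic_hausdorff_def using assms by (intro cInf_lower) (auto simp: bdd_below_def)

lemma conic_hausdorff_lessD:
  assumes "C \<noteq> {}" "D \<noteq> {}" "conic_hausdorff C D < \<epsilon>"
  obtains \<alpha> where "0 \<le> \<alpha>" "\<alpha> < \<epsilon>" "D \<subseteq> angular_expansion C \<alpha>" "C \<subseteq> angular_expansion D \<alpha>"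
  using cInf_lessD[OF conic_hausdorff_set_nonempty[OF assms(1,2)]] assms(3)
  unfolding conic_hausdorff_def by blast

text \<open>On the unit circle a chord is no longer than its arc.\<close>

lemma two_minus_two_cos_le: "2 - 2 * cos (\<alpha>::real) \<le> \<alpha>\<^sup>2"
proof -
  have "2 - 2 * cos \<alpha> = (2 * sin (\<alpha> / 2))\<^sup>2"
    using cos_double_sin[of "\<alpha> / 2"] by (simp add: power_mult_distrib)
  also have "\<dots> \<le> \<alpha>\<^sup>2"
    using abs_sin_x_le_abs_x[of "\<alpha> / 2"] by (intro power2_le_iff_abs_le[THEN iffD2] abs_le_square_iff[THEN iffD1]) (simp add: abs_mult)
  finally show ?thesis .
qed

text \<open>The residual contributes nonpositively against \<open>y \<in> C\<close>. Equality holds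
  for the direction of a nonzero projection, so the norm of the projection is a support function,
  and this is what makes it comparable between cones.\<close>

lemma inner_le_norm_closest_point_cone:
  fixes x :: "'a::euclidean_space"
  assumes C: "closed_convex_cone C" and y: "y \<in> C" "norm y = 1"
  shows "x \<bullet> y \<le> norm (closest_point C x)"
proof -
  have "x \<bullet> y = closest_point C x \<bullet> y + (x - closest_point C x) \<bullet> y" by (simp add: inner_diff_left)
  also have "\<dots> \<le> norm (closest_point C x) * norm y + 0"
    using closest_point_cone_polar[OF C y(1), of x] norm_cauchy_schwarz by (intro add_mono)
  finally show ?thesis using y by simp
qed

lemma norm_closest_point_cone_le:
  fixes x :: "'a::euclidean_space"
  assumes C: "closed_convex_cone C" and D: "closed_convex_cone D"
    and sub: "C \<subseteq> angular_expansion D \<alpha>" and \<alpha>: "0 \<le> \<alpha>" "\<alpha> < pi / 2"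
  shows "norm (closest_point C x) \<le> norm (closest_point D x) + norm x * \<alpha>"
proof (cases "closest_point C x = 0")
  case True
  then show ?thesis using \<alpha> by simp
next
  case False
  define p where "p = closest_point C x"
  have p: "p \<noteq> 0" "p \<in> C" "(x - p) \<bullet> p = 0"
    using False closest_point_cone[OF C, where x = x] by (auto simp: p_def)
  obtain y where y: "y \<in> D" "dist_s p y \<le> \<alpha>"
    using sub p(2) by (auto simp: angular_expansion_def)
  \<comment> \<open>The convention that a nonzero vector is at angle pi / 2 from 0 is the reason for
    requiring \<alpha> < pi / 2: it keeps \<open>y\<close> away from 0.\<close>
  then have y0: "y \<noteq> 0" and arc: "arccos (p \<bullet> y / (norm p * norm y)) \<le> \<alpha>"
    using p \<alpha> by (auto simp: dist_s_def split: if_splits)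
  define u w where "u = p /\<^sub>R norm p" and "w = y /\<^sub>R norm y"
  have uw: "norm u = 1" "norm w = 1" using p y0 by (auto simp: u_def w_def)
  have w: "w \<in> D" using closed_convex_coneD(6)[OF D y(1)] by (simp add: w_def)
  have "cos \<alpha> \<le> cos (arccos (p \<bullet> y / (norm p * norm y)))"
    using arc \<alpha> inner_divide_norms_bounds[of p y]
    by (intro cos_monotone_0_pi_le arccos_lbound) auto
  also have "\<dots> = p \<bullet> y / (norm p * norm y)"
    using inner_divide_norms_bounds[of p y] by (intro cos_arccos)
  also have "\<dots> = u \<bullet> w" by (simp add: u_def w_def field_simps)
  finally have "cos \<alpha> \<le> u \<bullet> w" .
  moreover have "(norm (u - w))\<^sup>2 = 2 - 2 * (u \<bullet> w)"
    using uw by (simp add: power2_norm_eq_inner inner_diff_left inner_diff_right inner_commute norm_eq_1)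
  ultimately have "(norm (u - w))\<^sup>2 \<le> \<alpha>\<^sup>2" using two_minus_two_cos_le[of \<alpha>] by linarith
  then have uw_le: "norm (u - w) \<le> \<alpha>" using \<alpha> power2_le_imp_le by blast
  have "norm p = x \<bullet> u"
  proof -
    have "x \<bullet> p = p \<bullet> p" using p(3) by (simp add: inner_diff_left)
    then show ?thesis using p(1) by (simp add: u_def dot_square_norm power2_eq_square)
  qed
  also have "\<dots> = x \<bullet> w + x \<bullet> (u - w)" by (simp add: inner_diff_right)
  also have "\<dots> \<le> norm (closest_point D x) + norm x * \<alpha>"
  proof (intro add_mono)
    show "x \<bullet> w \<le> norm (closest_point D x)" by (rule inner_le_norm_closest_point_cone[OF D w uw(2)])
    show "x \<bullet> (u - w) \<le> norm x * \<alpha>"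
      using norm_cauchy_schwarz[of x "u - w"] mult_left_mono[OF uw_le, of "norm x"] by simp
  qed
  finally show ?thesis by (simp add: p_def)
qed

lemma tendsto_norm_closest_point_cone:
  fixes x :: "'a::euclidean_space" and P :: "nat \<Rightarrow> 'a set"
  assumes C: "closed_convex_cone C" and P: "\<And>i. closed_convex_cone (P i)"
    and lim: "(\<lambda>i. conic_hausdorff (P i) C) \<longlonglongrightarrow> 0"
  shows "(\<lambda>i. norm (closest_point (P i) x)) \<longlonglongrightarrow> norm (closest_point C x)"
proof (rule tendstoI)
  fix e :: real assume e: "e > 0"
  \<comment> \<open>The summand 1 in the denominator covers \<open>x = 0\<close>.\<close>
  define \<delta> where "\<delta> = min (pi / 2) (e / (norm x + 1))"
  have \<delta>: "\<delta> > 0" using e by (simp add: \<delta>_def add_nonneg_pos)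
  have "eventually (\<lambda>i. conic_hausdorff (P i) C < \<delta>) sequentially"
    using order_tendstoD(2)[OF lim \<delta>] .
  then show "eventually (\<lambda>i. dist (norm (closest_point (P i) x)) (norm (closest_point C x)) < e) sequentially"
  proof eventually_elim
    case (elim i)
    then obtain \<alpha> where \<alpha>: "0 \<le> \<alpha>" "\<alpha> < \<delta>" "C \<subseteq> angular_expansion (P i) \<alpha>" "P i \<subseteq> angular_expansion C \<alpha>"
      using conic_hausdorff_lessD closed_convex_coneD(3)[OF C] closed_convex_coneD(3)[OF P] by metis
    have a: "\<alpha> < pi / 2" "\<alpha> < e / (norm x + 1)" using \<alpha>(2) by (auto simp: \<delta>_def)
    have "norm x * \<alpha> \<le> (norm x + 1) * \<alpha>" using \<alpha>(1) by (simp add: algebra_simps)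
    also have "\<dots> < e" using a(2) by (simp add: pos_less_divide_eq add_nonneg_pos mult.commute)
    finally have "norm x * \<alpha> < e" .
    then show ?case
      using norm_closest_point_cone_le[OF C P \<alpha>(3,1) a(1), of x]
        norm_closest_point_cone_le[OF P C \<alpha>(4,1) a(1), of x]
      by (simp add: dist_real_def)
  qed
qed

lemma tendsto_cone_gauss:
  fixes P :: "nat \<Rightarrow> 'a::euclidean_space set"
  assumes C: "closed_convex_cone C" and P: "\<And>i. closed_convex_cone (P i)"
    and lim: "(\<lambda>i. conic_hausdorff (P i) C) \<longlonglongrightarrow> 0" and s: "s > 0"
  shows "(\<lambda>i. cone_gauss (P i) s) \<longlonglongrightarrow> cone_gauss C s"
  unfolding cone_gauss_def
proof (rule nn_integral_dominated_convergence)
  let ?w = "\<lambda>x::'a. ennreal (std_gaussian_density ((1 / sqrt (max 1 s)) *\<^sub>R x))"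
  show "(\<integral>\<^sup>+x. ?w x \<partial>lborel) < \<infinity>"
    by (rule nn_integral_std_gaussian_density_scaled) simp
  show "AE x in lborel. ennreal (cone_gauss_density (P i) s x) \<le> ?w x" for i
    by (intro always_eventually allI ennreal_leI cone_gauss_density_le P s)
  \<comment> \<open>Pythagoras expresses the energy through the norm of the projection alone, so
    convergence of these norms is enough.\<close>
  have energy: "cone_energy D s x = (norm (closest_point D x))\<^sup>2 / s + ((norm x)\<^sup>2 - (norm (closest_point D x))\<^sup>2)"
    if "closed_convex_cone D" for D and x :: 'a
    using norm_closest_point_cone[OF that, of x] by (simp add: cone_energy_def)
  have "(\<lambda>i. cone_gauss_density (P i) s x) \<longlonglongrightarrow> cone_gauss_density C s x" for x
    unfolding cone_gauss_density_def energy[OF C] energy[OF P]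
    using s by (intro tendsto_intros tendsto_norm_closest_point_cone[OF C P lim]) auto
  then show "AE x in lborel. (\<lambda>i. ennreal (cone_gauss_density (P i) s x)) \<longlonglongrightarrow> ennreal (cone_gauss_density C s x)"
    by (intro always_eventually allI tendsto_ennrealI)
qed (use measurable_cone_gauss_density[OF P] measurable_cone_gauss_density[OF C] in auto)

lemma cone_gauss_finite:
  fixes C :: "'a::euclidean_space set"
  assumes C: "closed_convex_cone C" and s: "s > 0"
  shows "cone_gauss C s < \<infinity>"
proof -
  have "cone_gauss C s \<le> (\<integral>\<^sup>+x. ennreal (std_gaussian_density ((1 / sqrt (max 1 s)) *\<^sub>R (x :: 'a))) \<partial>lborel)"
    unfolding cone_gauss_def by (intro nn_integral_mono ennreal_leI cone_gauss_density_le C s)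
  also have "\<dots> < \<infinity>" by (rule nn_integral_std_gaussian_density_scaled) simp
  finally show ?thesis .
qed

section \<open>Density of the polyhedral cones\<close>

lemma polyhedral_cone_if_polyhedron:
  fixes C :: "'a::euclidean_space set"
  assumes C: "closed_convex_cone C" and poly: "polyhedron C"
  shows "polyhedral_cone C"
proof -
  obtain F where F: "finite F" "C = \<Inter>F" "\<And>h. h \<in> F \<Longrightarrow> \<exists>a b. a \<noteq> 0 \<and> h = {x. a \<bullet> x \<le> b}"
    using poly unfolding polyhedron_def by blast
  then obtain a b where ab: "\<And>h. h \<in> F \<Longrightarrow> h = {x. a h \<bullet> x \<le> b h}" by metis
  note D = closed_convex_coneD[OF C]
  have "C = {x. \<forall>u\<in>(\<lambda>h. - a h) ` F. 0 \<le> u \<bullet> x}"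
  proof (intro subset_antisym subsetI)
    fix x assume x: "x \<in> C"
    have "a h \<bullet> x \<le> 0" if h: "h \<in> F" for h
    proof (rule ccontr)
      assume "\<not> a h \<bullet> x \<le> 0"
      then have pos: "a h \<bullet> x > 0" by simp
      \<comment> \<open>The multiple of \<open>x\<close> at which the linear form takes the value
        |b| + 1, beyond the bound of the halfspace.\<close>
      then have "((\<bar>b h\<bar> + 1) / (a h \<bullet> x)) *\<^sub>R x \<in> C" by (intro D(6) x) auto
      then have "a h \<bullet> (((\<bar>b h\<bar> + 1) / (a h \<bullet> x)) *\<^sub>R x) \<le> b h" using ab[OF h] F(2) h by blast
      then show False using pos by simp
    qed
    then show "x \<in> {x. \<forall>u\<in>(\<lambda>h. - a h) ` F. 0 \<le> u \<bullet> x}" by simp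
  next
    fix x assume x: "x \<in> {x. \<forall>u\<in>(\<lambda>h. - a h) ` F. 0 \<le> u \<bullet> x}"
    have "x \<in> h" if h: "h \<in> F" for h
    proof -
      have "0 \<in> h" using D(4) F(2) h by blast
      then have "0 \<le> b h" using ab[OF h] by (metis inner_zero_right mem_Collect_eq)
      then have "a h \<bullet> x \<le> b h" using x h by force
      then show ?thesis using ab[OF h] by blast
    qed
    then show "x \<in> C" using F(2) by blast
  qed
  then show ?thesis using F(1) unfolding polyhedral_cone_def by blast
qed

text \<open>The approximating cone is generated by a finite net of the unit vectors of
  \<open>C\<close>, which exists by compactness. The mesh \<eta> is the chord that subtends the
  angle \<alpha>.\<close>

lemma polyhedral_cone_approximation:
  fixes C :: "'a::euclidean_space set"
  assumes C: "closed_convex_cone C" and \<epsilon>: "0 < \<epsilon>"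
  obtains P where "polyhedral_cone P" "conic_hausdorff P C \<le> \<epsilon>"
proof -
  note D = closed_convex_coneD[OF C]
  \<comment> \<open>The cap at 1 keeps \<alpha> within [0, pi], where \<open>arccos\<close> inverts
    \<open>cos\<close>.\<close>
  define \<alpha> where "\<alpha> = min \<epsilon> 1"
  have \<alpha>: "0 < \<alpha>" "\<alpha> \<le> \<epsilon>" "\<alpha> \<le> pi" using \<epsilon> pi_gt3 by (auto simp: \<alpha>_def)
  have "cos \<alpha> < cos 0" using \<alpha> by (intro cos_monotone_0_pi) auto
  then have c1: "cos \<alpha> < 1" by simp
  define \<eta> where "\<eta> = sqrt (2 - 2 * cos \<alpha>)"
  have \<eta>: "\<eta> > 0" using c1 by (simp add: \<eta>_def)
  have "compact (C \<inter> sphere 0 1)" using D(1) by (intro closed_Int_compact) auto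
  then obtain N where N: "finite N" "N \<subseteq> C \<inter> sphere 0 1" "C \<inter> sphere 0 1 \<subseteq> (\<Union>y\<in>N. ball y \<eta>)"
    using compactE_image[of "C \<inter> sphere 0 1" "C \<inter> sphere 0 1" "\<lambda>y. ball y \<eta>"] \<eta> by force
  define P where "P = convex_cone hull N"
  have PC: "P \<subseteq> C" unfolding P_def
    by (rule hull_minimal) (use N(2) C in \<open>simp_all add: closed_convex_cone_def\<close>)
  have P: "closed_convex_cone P"
    using N(1) by (simp add: P_def closed_convex_cone_def closed_convex_cone_hull convex_cone_convex_cone_hull)
  have poly: "polyhedral_cone P"
    using N(1) P by (intro polyhedral_cone_if_polyhedron) (simp_all add: P_def polyhedron_convex_cone_hull)
  have "conic_hausdorff P C \<le> \<alpha>"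
  proof (rule conic_hausdorff_le)
    show "0 \<le> \<alpha>" using \<alpha> by simp
    have refl: "dist_s x x = 0" for x :: 'a
      by (simp add: dist_s_def dot_square_norm power2_eq_square)
    show "P \<subseteq> angular_expansion C \<alpha>"
      using PC \<alpha> refl unfolding angular_expansion_def by (metis (mono_tags, lifting) less_imp_le mem_Collect_eq subsetD subsetI)
    show "C \<subseteq> angular_expansion P \<alpha>"
    proof
      fix x assume x: "x \<in> C"
      show "x \<in> angular_expansion P \<alpha>"
      proof (cases "x = 0")
        case True
        then show ?thesis using closed_convex_coneD(4)[OF P] refl[of 0] \<alpha>
          by (auto simp: angular_expansion_def intro!: bexI[of _ 0])
      next
        case False
        define u where "u = x /\<^sub>R norm x"
        have "u \<in> C \<inter> sphere 0 1" using D(6)[OF x] False by (simp add: u_def)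
        then obtain y where y: "y \<in> N" "dist y u < \<eta>" and u: "norm u = 1" using N(3) by auto
        have yn: "norm y = 1" using y(1) N(2) by auto
        then have y0: "y \<noteq> 0" by auto
        have "(norm (y - u))\<^sup>2 \<le> \<eta>\<^sup>2" using y(2) by (simp add: dist_norm power_mono)
        also have "\<eta>\<^sup>2 = 2 - 2 * cos \<alpha>" using c1 by (simp add: \<eta>_def)
        finally have "cos \<alpha> \<le> u \<bullet> y"
          using u yn by (simp add: power2_norm_eq_inner inner_diff_left inner_diff_right inner_commute[of y u] norm_eq_1)
        moreover have uy: "u \<bullet> y = x \<bullet> y / (norm x * norm y)" using yn by (simp add: u_def divide_inverse mult.commute)
        ultimately have "arccos (x \<bullet> y / (norm x * norm y)) \<le> arccos (cos \<alpha>)"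
          using inner_divide_norms_bounds[of x y] by (subst arccos_le_mono) (simp_all add: abs_le_iff)
        then have "dist_s x y \<le> \<alpha>" using False y0 \<alpha> by (simp add: dist_s_def arccos_cos)
        moreover have "y \<in> P" using y(1) unfolding P_def by (rule hull_inc)
        ultimately show ?thesis by (auto simp: angular_expansion_def)
      qed
    qed
  qed
  then show ?thesis using that[OF poly] \<alpha> by simp
qed

lemma polyhedral_cones_dense:
  fixes C :: "'a::euclidean_space set"
  assumes C: "closed_convex_cone C"
  obtains P :: "nat \<Rightarrow> 'a set" where "\<And>i. polyhedral_cone (P i)" "(\<lambda>i. conic_hausdorff (P i) C) \<longlonglongrightarrow> 0"
proof -
  have "\<exists>P. polyhedral_cone P \<and> conic_hausdorff P C \<le> inverse (real (Suc i))" for i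
    using polyhedral_cone_approximation[OF C, of "inverse (real (Suc i))"] by auto
  then obtain P where P: "\<And>i. polyhedral_cone (P i)" "\<And>i. conic_hausdorff (P i) C \<le> inverse (real (Suc i))"
    by metis
  have "0 \<le> conic_hausdorff (P i) C" for i
    using conic_hausdorff_nonneg closed_convex_coneD(3)[OF C]
      closed_convex_coneD(3)[OF polyhedral_cone_imp_closed_convex_cone[OF P(1)]] by blast
  then have "(\<lambda>i. conic_hausdorff (P i) C) \<longlonglongrightarrow> 0"
    using P(2) by (intro tendsto_sandwich[OF _ _ tendsto_const LIMSEQ_inverse_real_of_nat]) auto
  then show ?thesis using that P(1) by blast
qed

section \<open>Recovering the intrinsic volumes from their generating polynomial\<close>

lemma polynomial_coeffs_convergent:
  fixes a :: "nat \<Rightarrow> nat \<Rightarrow> real"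
  assumes "\<And>z. z > 0 \<Longrightarrow> convergent (\<lambda>i. \<Sum>k\<le>d. a i k * z ^ k)" and "k \<le> d"
  shows "convergent (\<lambda>i. a i k)"
  using assms
proof (induction d arbitrary: a k)
  case 0
  then show ?case using "0.prems"(1)[of 1] by simp
next
  case (Suc d)
  \<comment> \<open>The value of the polynomial at \<open>2 * z\<close> minus
    \<open>2 ^ Suc d\<close> times its value at \<open>z\<close> has no top coefficient, while every
    lower coefficient is multiplied by a nonzero constant.\<close>
  define b where "b i k = (2 ^ k - 2 ^ Suc d) * a i k" for i k
  have low: "convergent (\<lambda>i. a i k)" if k: "k \<le> d" for k
  proof -
    have "convergent (\<lambda>i. b i k)"
    proof (rule Suc.IH[OF _ k])
      fix z :: real assume z: "z > 0"
      have "(\<Sum>k\<le>d. b i k * z ^ k) =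
          (\<Sum>k\<le>Suc d. a i k * (2 * z) ^ k) - 2 ^ Suc d * (\<Sum>k\<le>Suc d. a i k * z ^ k)" for i
        by (simp add: b_def power_mult_distrib algebra_simps sum_subtractf sum_distrib_left)
      then show "convergent (\<lambda>i. \<Sum>k\<le>d. b i k * z ^ k)"
        using Suc.prems(1)[of z] Suc.prems(1)[of "2 * z"] z
        by (simp only:) (intro convergent_diff convergent_mult convergent_const; simp)
    qed
    then have "convergent (\<lambda>i. (1 / (2 ^ k - 2 ^ Suc d)) * b i k)"
      by (intro convergent_mult convergent_const)
    moreover have "(2::real) ^ k - 2 ^ Suc d \<noteq> 0" using k power_strict_increasing[of k "Suc d" "2::real"] by simp
    ultimately show ?thesis by (simp add: b_def)
  qed
  show ?case
  proof (cases "k \<le> d")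
    case False
    then have k: "k = Suc d" using Suc.prems(2) by simp
    have "convergent (\<lambda>i. (\<Sum>k\<le>Suc d. a i k * 1 ^ k) - (\<Sum>k\<le>d. a i k))"
      by (intro convergent_diff convergent_sum low Suc.prems(1)) auto
    then show ?thesis by (simp add: k)
  qed (rule low)
qed

lemma polynomial_coeffs_eq:
  fixes a b :: "nat \<Rightarrow> real"
  assumes eq: "\<And>z. z > 0 \<Longrightarrow> (\<Sum>k\<le>d. a k * z ^ k) = (\<Sum>k\<le>d. b k * z ^ k)" and k: "k \<le> d"
  shows "a k = b k"
proof -
  have "{0<..} \<subseteq> {z::real. (\<Sum>k\<le>d. (a k - b k) * z ^ k) = 0}"
    using eq by (auto simp: left_diff_distrib sum_subtractf)
  then have "infinite {z::real. (\<Sum>k\<le>d. (a k - b k) * z ^ k) = 0}"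
    using infinite_Ioi finite_subset by blast
  then show ?thesis using polyfun_finite_roots[of "\<lambda>k. a k - b k" d] k by auto
qed

text \<open>The Steiner polynomials of the approximating cones converge pointwise to the Gaussian
  integral of \<open>C\<close>, hence so do their coefficients. The limit \<open>l\<close> could
  depend on the sequence, but its generating function depends on \<open>C\<close> alone.\<close>

lemma polyhedral_intrinsic_volumes_tendsto:
  fixes P :: "nat \<Rightarrow> 'a::euclidean_space set"
  assumes C: "closed_convex_cone C" and P: "\<And>i. polyhedral_cone (P i)"
    and lim: "(\<lambda>i. conic_hausdorff (P i) C) \<longlonglongrightarrow> 0"
  obtains l where "\<And>k. k \<le> DIM('a) \<Longrightarrow> (\<lambda>i. polyhedral_intrinsic_volume (P i) k) \<longlonglongrightarrow> l k"
    "\<And>z. z > 0 \<Longrightarrow> cone_gauss C (z\<^sup>2) = ennreal (\<Sum>k\<le>DIM('a). l k * z ^ k)"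
    "\<And>k. k \<le> DIM('a) \<Longrightarrow> 0 \<le> l k"
proof -
  let ?a = "\<lambda>i. polyhedral_intrinsic_volume (P i)"
  let ?p = "\<lambda>i z. \<Sum>k\<le>DIM('a). ?a i k * z ^ k"
  have nn: "0 \<le> ?a i k" for i k by (simp add: polyhedral_intrinsic_volume_def)
  have pn: "0 \<le> ?p i z" if "z > 0" for i z using nn that by (intro sum_nonneg mult_nonneg_nonneg) auto
  have p_lim: "(\<lambda>i. ?p i z) \<longlonglongrightarrow> enn2real (cone_gauss C (z\<^sup>2))" if z: "z > 0" for z
  proof -
    have "(\<lambda>i. ennreal (?p i z)) \<longlonglongrightarrow> cone_gauss C (z\<^sup>2)"
      using tendsto_cone_gauss[OF C polyhedral_cone_imp_closed_convex_cone[OF P] lim, of "z\<^sup>2"] z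
      by (simp add: polyhedral_Steiner[OF P])
    then have "(\<lambda>i. enn2real (ennreal (?p i z))) \<longlonglongrightarrow> enn2real (cone_gauss C (z\<^sup>2))"
      using cone_gauss_finite[OF C, of "z\<^sup>2"] z by (intro tendsto_enn2real) auto
    then show ?thesis using pn[OF z] by simp
  qed
  define l where "l k = lim (\<lambda>i. ?a i k)" for k
  have l: "(\<lambda>i. ?a i k) \<longlonglongrightarrow> l k" if "k \<le> DIM('a)" for k
    unfolding l_def using polynomial_coeffs_convergent[OF _ that, of ?a] p_lim
    by (auto simp: convergent_LIMSEQ_iff[symmetric] intro: convergentI)
  have "cone_gauss C (z\<^sup>2) = ennreal (\<Sum>k\<le>DIM('a). l k * z ^ k)" if z: "z > 0" for z
  proof -
    have "(\<lambda>i. ?p i z) \<longlonglongrightarrow> (\<Sum>k\<le>DIM('a). l k * z ^ k)"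
      by (intro tendsto_intros l) simp
    then have "enn2real (cone_gauss C (z\<^sup>2)) = (\<Sum>k\<le>DIM('a). l k * z ^ k)"
      using p_lim[OF z] LIMSEQ_unique by blast
    then show ?thesis using cone_gauss_finite[OF C, of "z\<^sup>2"] z by (metis ennreal_enn2real infinity_ennreal_def zero_less_power)
  qed
  moreover have "0 \<le> l k" if "k \<le> DIM('a)" for k
    using LIMSEQ_le_const[OF l[OF that]] nn by blast
  ultimately show ?thesis using that l by blast
qed

text \<open>For a cone that is not polyhedral the definite description has to be resolved. One
  approximating sequence supplies the value, and any other sequence has the same limit because the
  two limiting polynomials agree for positive arguments.\<close>

lemma conic_intrinsic_volume_Steiner:
  fixes C :: "'a::euclidean_space set"
  assumes C: "closed_convex_cone C"
  shows conic_intrinsic_volume_nonneg: "k \<le> DIM('a) \<Longrightarrow> 0 \<le> conic_intrinsic_volume C k"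
    and conic_Steiner: "z > 0 \<Longrightarrow>
      cone_gauss C (z\<^sup>2) = ennreal (\<Sum>k\<le>DIM('a). conic_intrinsic_volume C k * z ^ k)"
proof -
  have "(\<forall>k\<le>DIM('a). 0 \<le> conic_intrinsic_volume C k) \<and>
    (\<forall>z>0. cone_gauss C (z\<^sup>2) = ennreal (\<Sum>k\<le>DIM('a). conic_intrinsic_volume C k * z ^ k))"
  proof (cases "polyhedral_cone C")
    case True
    then show ?thesis
      by (simp add: conic_intrinsic_volume_def polyhedral_Steiner) (simp add: polyhedral_intrinsic_volume_def)
  next
    case False
    obtain P where P: "\<And>i. polyhedral_cone (P i)" "(\<lambda>i. conic_hausdorff (P i) C) \<longlonglongrightarrow> 0"
      using polyhedral_cones_dense[OF C] by blast
    obtain l where l: "\<And>k. k \<le> DIM('a) \<Longrightarrow> (\<lambda>i. polyhedral_intrinsic_volume (P i) k) \<longlonglongrightarrow> l k"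
      "\<And>z. z > 0 \<Longrightarrow> cone_gauss C (z\<^sup>2) = ennreal (\<Sum>k\<le>DIM('a). l k * z ^ k)"
      "\<And>k. k \<le> DIM('a) \<Longrightarrow> 0 \<le> l k"
      using polyhedral_intrinsic_volumes_tendsto[OF C P] by blast
    have v: "conic_intrinsic_volume C k = l k" if k: "k \<le> DIM('a)" for k
    proof -
      have "(THE l. \<forall>P :: nat \<Rightarrow> 'a set. (\<forall>i. polyhedral_cone (P i)) \<longrightarrow>
          (\<lambda>i. conic_hausdorff (P i) C) \<longlonglongrightarrow> 0 \<longrightarrow>
          (\<lambda>i. polyhedral_intrinsic_volume (P i) k) \<longlonglongrightarrow> l) = l k"
      proof (rule the_equality, intro allI impI)
        fix Q :: "nat \<Rightarrow> 'a set"
        assume Q: "\<forall>i. polyhedral_cone (Q i)" "(\<lambda>i. conic_hausdorff (Q i) C) \<longlonglongrightarrow> 0"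
        obtain m where m: "\<And>k. k \<le> DIM('a) \<Longrightarrow> (\<lambda>i. polyhedral_intrinsic_volume (Q i) k) \<longlonglongrightarrow> m k"
          "\<And>z. z > 0 \<Longrightarrow> cone_gauss C (z\<^sup>2) = ennreal (\<Sum>k\<le>DIM('a). m k * z ^ k)"
          "\<And>k. k \<le> DIM('a) \<Longrightarrow> 0 \<le> m k"
          using polyhedral_intrinsic_volumes_tendsto[OF C _ Q(2)] Q(1) by blast
        have "m k = l k"
        proof (rule polynomial_coeffs_eq[OF _ k])
          fix z :: real assume z: "z > 0"
          have "ennreal (\<Sum>k\<le>DIM('a). m k * z ^ k) = ennreal (\<Sum>k\<le>DIM('a). l k * z ^ k)"
            using l(2) m(2) z by metis
          then show "(\<Sum>k\<le>DIM('a). m k * z ^ k) = (\<Sum>k\<le>DIM('a). l k * z ^ k)"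
            using l(3) m(3) z by (subst (asm) ennreal_inj) (auto intro!: sum_nonneg mult_nonneg_nonneg)
        qed
        then show "(\<lambda>i. polyhedral_intrinsic_volume (Q i) k) \<longlonglongrightarrow> l k" using m(1)[OF k] by simp
      next
        \<comment> \<open>Density is used here: without an approximating sequence the assumption
          would be vacuous and would not determine \<open>l'\<close>.\<close>
        fix l' assume "\<forall>P :: nat \<Rightarrow> 'a set. (\<forall>i. polyhedral_cone (P i)) \<longrightarrow>
          (\<lambda>i. conic_hausdorff (P i) C) \<longlonglongrightarrow> 0 \<longrightarrow>
          (\<lambda>i. polyhedral_intrinsic_volume (P i) k) \<longlonglongrightarrow> l'"
        then show "l' = l k" using P l(1)[OF k] LIMSEQ_unique by blast
      qed
      then show ?thesis using False by (simp add: conic_intrinsic_volume_def)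
    qed
    show ?thesis using l v by simp
  qed
  then show "k \<le> DIM('a) \<Longrightarrow> 0 \<le> conic_intrinsic_volume C k"
    "z > 0 \<Longrightarrow> cone_gauss C (z\<^sup>2) = ennreal (\<Sum>k\<le>DIM('a). conic_intrinsic_volume C k * z ^ k)"
    by auto
qed

subsection \<open>Tail bounds\<close>

text \<open>Iterating the midpoint inequality towards \<open>s = 1\<close> leaves the tangent of
  \<open>s \<mapsto> ln (\<Sum>k\<le>d. a k * (sqrt s) ^ k)\<close> at \<open>s = 1\<close>.\<close>

lemma polynomial_le_exp_of_midpoint:
  fixes a :: "nat \<Rightarrow> real"
  assumes nn: "\<And>k. k \<le> d \<Longrightarrow> 0 \<le> a k" and sum1: "(\<Sum>k\<le>d. a k) = 1"
    and mid: "\<And>s. s > 0 \<Longrightarrow> (\<Sum>k\<le>d. a k * sqrt s ^ k) \<le> (\<Sum>k\<le>d. a k * sqrt ((1 + s) / 2) ^ k)\<^sup>2"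
    and z: "z > 0"
  shows "(\<Sum>k\<le>d. a k * z ^ k) \<le> exp ((\<Sum>k\<le>d. real k * a k) * (z\<^sup>2 - 1) / 2)"
proof -
  define p where "p z = (\<Sum>k\<le>d. a k * z ^ k)" for z
  \<comment> \<open>With s = 1 + u the base point becomes u = 0, and halving \<open>u\<close> takes
    s to the midpoint of 1 and s.\<close>
  define q where "q u = ln (p (sqrt (1 + u)))" for u
  define D where "D = (\<Sum>k\<le>d. real k * a k)"
  have p_pos: "p z > 0" if "z > 0" for z
  proof -
    have "0 \<le> a k * z ^ k" if "k \<le> d" for k using nn[OF that] \<open>z > 0\<close> by simp
    moreover have "\<exists>k\<le>d. a k \<noteq> 0"
      using sum1 by (metis atMost_iff sum.neutral zero_neq_one)
    ultimately show ?thesis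
      unfolding p_def using nn \<open>z > 0\<close>
      by (metis (no_types, lifting) atMost_iff finite_atMost less_eq_real_def mult_eq_0_iff
          power_not_zero sum_nonneg sum_nonneg_eq_0_iff order_less_irrefl)
  qed
  have step: "q u \<le> 2 * q (u / 2)" if "u > - 1" for u
  proof -
    have "p (sqrt (1 + u)) \<le> (p (sqrt ((1 + (1 + u)) / 2)))\<^sup>2"
      using mid[of "1 + u"] that by (simp add: p_def)
    moreover have "(1 + (1 + u)) / 2 = 1 + u / 2" by simp
    ultimately have "p (sqrt (1 + u)) \<le> (p (sqrt (1 + u / 2)))\<^sup>2" by metis
    moreover have pos: "p (sqrt (1 + u)) > 0" "p (sqrt (1 + u / 2)) > 0"
      using that by (auto intro!: p_pos)
    ultimately have "q u \<le> ln ((p (sqrt (1 + u / 2)))\<^sup>2)"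
      unfolding q_def by (subst ln_le_cancel_iff) auto
    also have "\<dots> = 2 * q (u / 2)"
      using pos by (simp add: q_def ln_realpow)
    finally show ?thesis .
  qed
  have iter: "q u \<le> 2 ^ n * q (u / 2 ^ n)" if u: "u > - 1" for u n
  proof (induction n)
    case (Suc n)
    have "1 / 2 ^ n \<le> (1::real)" by (simp add: divide_le_eq)
    moreover have "- (1 / 2 ^ n) < u / 2 ^ n"
      using divide_strict_right_mono[OF u, of "2 ^ n"] by simp
    ultimately have "u / 2 ^ n > - 1" by linarith
    note Suc.IH
    also have "2 ^ n * q (u / 2 ^ n) \<le> 2 ^ n * (2 * q (u / 2 ^ n / 2))"
      using \<open>u / 2 ^ n > - 1\<close> by (intro mult_left_mono step) auto
    also have "\<dots> = 2 ^ Suc n * q (u / 2 ^ Suc n)" by (simp add: mult_ac)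
    finally show ?case .
  qed simp
  have p1: "p 1 = 1" using sum1 by (simp add: p_def)
  \<comment> \<open>\<open>D\<close> is the mean; the factor 1/2 is the derivative of the square
    root at 1.\<close>
  have deriv: "(q has_real_derivative D / 2) (at 0)"
  proof -
    have dp: "(p has_real_derivative D) (at 1)"
      unfolding p_def[abs_def] D_def
      by (auto intro!: derivative_eq_intros sum.cong)
    have ds: "((\<lambda>u. sqrt (1 + u)) has_real_derivative 1 / 2) (at 0)"
      by (auto intro!: derivative_eq_intros)
    have "((\<lambda>u. p (sqrt (1 + u))) has_real_derivative D * (1 / 2)) (at 0)"
      by (rule DERIV_chain2[OF _ ds]) (simp add: dp)
    then show ?thesis
      unfolding q_def[abs_def] by (auto intro!: derivative_eq_intros simp: p1)
  qed
  define u where "u = z\<^sup>2 - 1"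
  have u: "u > - 1" using z by (simp add: u_def)
  have "q u \<le> D / 2 * u"
  proof (cases "u = 0")
    case True
    then show ?thesis by (simp add: q_def p1)
  next
    case False
    \<comment> \<open>Since \<open>q 0 = 0\<close>, the quantity
      \<open>2 ^ n * q (u / 2 ^ n)\<close> is \<open>u\<close> times a difference quotient of
      \<open>q\<close> at 0.\<close>
    have "(\<lambda>h. q h / h) \<midarrow>0\<rightarrow> D / 2"
      using deriv by (simp add: has_field_derivative_iff q_def p1)
    moreover have "filterlim (\<lambda>n. u / 2 ^ n) (at 0) sequentially"
    proof (rule filterlim_atI)
      show "(\<lambda>n. u / 2 ^ n) \<longlonglongrightarrow> 0"
        using LIMSEQ_divide_realpow_zero[of 2 u] by simp
      show "\<forall>\<^sub>F n in sequentially. u / 2 ^ n \<noteq> 0" using False by simp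
    qed
    ultimately have "(\<lambda>n. q (u / 2 ^ n) / (u / 2 ^ n)) \<longlonglongrightarrow> D / 2"
      by (rule filterlim_compose)
    then have "(\<lambda>n. q (u / 2 ^ n) / (u / 2 ^ n) * u) \<longlonglongrightarrow> D / 2 * u"
      by (intro tendsto_mult tendsto_const)
    then have "(\<lambda>n. 2 ^ n * q (u / 2 ^ n)) \<longlonglongrightarrow> D / 2 * u"
      using False by (simp add: field_simps)
    then show ?thesis using iter[OF u] by (intro LIMSEQ_le_const) auto
  qed
  then have "exp (q u) \<le> exp (D / 2 * u)" by simp
  then have "p (sqrt (1 + u)) \<le> exp (D / 2 * u)"
    using p_pos[of "sqrt (1 + u)"] u by (simp add: q_def)
  then show ?thesis using z by (simp add: u_def p_def D_def)
qed

section \<open>Chernoff bounds under a Poisson-type bound on the moment generating function\<close>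

lemma Chernoff_pmf_ge:
  fixes X :: "'b \<Rightarrow> real"
  assumes fin: "finite (set_pmf p)" and \<eta>: "\<eta> \<ge> 0"
  shows "measure_pmf.prob p {k. X k \<ge> t} \<le> exp (- \<eta> * t) * measure_pmf.expectation p (\<lambda>k. exp (\<eta> * X k))"
proof -
  have "measure_pmf.prob p {k. X k \<ge> t} = measure_pmf.expectation p (indicator {k. X k \<ge> t})" by simp
  also have "\<dots> \<le> measure_pmf.expectation p (\<lambda>k. exp (- \<eta> * t) * exp (\<eta> * X k))"
  proof (rule integral_mono)
    show "indicator {k. X k \<ge> t} k \<le> exp (- \<eta> * t) * exp (\<eta> * X k)" for k
      using \<eta> by (auto simp: indicator_def mult_left_mono simp flip: exp_add)
  qed (auto intro!: integrable_measure_pmf_finite fin)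
  finally show ?thesis by simp
qed

text \<open>This \<eta> minimises the Chernoff exponent on the left: the derivative vanishes when
  exp (2 \<eta>) = 1 + u / \<delta>. The sign of \<open>u\<close> is left open so that one identity
  serves both tails.\<close>

lemma exponent_eq_psi:
  fixes \<delta> u :: real
  assumes \<delta>: "\<delta> > 0" and u: "1 + u / \<delta> > 0"
  defines "\<eta> \<equiv> ln (1 + u / \<delta>) / 2"
  shows "- \<eta> * (\<delta> + u) + \<delta> * (exp (2 * \<eta>) - 1) / 2 =
    - (\<delta> * ((1 + u / \<delta>) * ln (1 + u / \<delta>) - u / \<delta>)) / 2"
proof -
  have e: "exp (2 * \<eta>) = 1 + u / \<delta>" using u by (simp add: \<eta>_def)
  have "\<delta> + u = \<delta> * (1 + u / \<delta>)" using \<delta> by (simp add: field_simps)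
  then show ?thesis unfolding e using \<delta> by (simp add: \<eta>_def field_simps)
qed

lemma exp_ereal_scaled_psi:
  assumes "\<delta> > 0" "- 1 \<le> u / \<delta>"
  shows "exp_ereal (- (1 / 2) * scaled_psi \<delta> u) =
    ereal (exp (- (\<delta> * ((1 + u / \<delta>) * ln (1 + u / \<delta>) - u / \<delta>)) / 2))"
proof -
  have half: "- (1 / 2) = ereal (- 1 / 2)" by (simp add: one_ereal_def numeral_eq_ereal)
  show ?thesis using assms unfolding half by (simp add: scaled_psi_def psi_def exp_ereal_def)
qed

lemma exp_ereal_infinity: "exp_ereal (- (1 / 2) * \<infinity>) = 0"
proof -
  have half: "- (1 / 2) = ereal (- 1 / 2)" by (simp add: one_ereal_def numeral_eq_ereal)
  show ?thesis unfolding half by (simp add: exp_ereal_def)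
qed

text \<open>The variable is kept abstract because the bounds are applied twice under the same law:
  to V with mean \<delta>(C), and to d - V with mean \<delta>(polar cone).\<close>

context
  fixes p :: "'b pmf" and X :: "'b \<Rightarrow> real" and \<delta> :: real
  assumes fin: "finite (set_pmf p)" and X_nn: "\<And>k. k \<in> set_pmf p \<Longrightarrow> 0 \<le> X k"
    and mean: "measure_pmf.expectation p X = \<delta>"
    and mgf: "\<And>\<eta>. measure_pmf.expectation p (\<lambda>k. exp (\<eta> * X k)) \<le> exp (\<delta> * (exp (2 * \<eta>) - 1) / 2)"
begin

lemma mean_nonneg: "0 \<le> \<delta>"
  unfolding mean[symmetric] using X_nn by (intro integral_nonneg_AE) (auto simp: AE_measure_pmf_iff)

text \<open>A nonnegative variable of mean 0 vanishes almost surely. This justifies the value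
  \<infinity> of \<open>scaled_psi 0 t\<close> for positive \<open>t\<close>, for which the tail
  bound asserts probability 0.\<close>

lemma prob_eq_0_of_mean_0:
  assumes "\<delta> = 0" "t > 0"
  shows "measure_pmf.prob p {k. X k \<ge> t} = 0"
proof -
  have "AE k in measure_pmf p. X k = 0"
    using mean assms(1) X_nn
    by (subst integral_nonneg_eq_0_iff_AE[symmetric])
       (auto simp: AE_measure_pmf_iff intro!: integrable_measure_pmf_finite fin)
  then show ?thesis using assms(2) by (auto simp: measure_pmf_zero_iff AE_measure_pmf_iff)
qed

lemma prob_nonneg_lower_eq_0:
  assumes "t < 0"
  shows "measure_pmf.prob p {k. X k \<le> t} = 0"
  using X_nn assms by (force simp: measure_pmf_zero_iff)

lemma scaled_psi_upper_tail:
  assumes t: "t \<ge> 0"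
  shows "ereal (measure_pmf.prob p {k. X k - \<delta> \<ge> t}) \<le> exp_ereal (- (1 / 2) * scaled_psi \<delta> t)"
proof -
  consider "\<delta> = 0" "t = 0" | "\<delta> = 0" "t > 0" | "\<delta> > 0" using mean_nonneg t by linarith
  then show ?thesis
  proof cases
    case 1
    then show ?thesis by (simp add: scaled_psi_def psi_def exp_ereal_def zero_ereal_def)
  next
    case 2
    then have "scaled_psi \<delta> t = \<infinity>" by (simp add: scaled_psi_def)
    moreover have "{k. X k - \<delta> \<ge> t} = {k. X k \<ge> t}" using 2 by auto
    ultimately show ?thesis using prob_eq_0_of_mean_0[OF 2] by (simp only: exp_ereal_infinity) simp
  next
    case 3
    have r: "1 + t / \<delta> \<ge> 1" using 3 t by simp
    define \<eta> where "\<eta> = ln (1 + t / \<delta>) / 2"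
    have \<eta>: "\<eta> \<ge> 0" using r by (simp add: \<eta>_def)
    have "measure_pmf.prob p {k. X k - \<delta> \<ge> t} \<le>
        exp (- \<eta> * (\<delta> + t)) * measure_pmf.expectation p (\<lambda>k. exp (\<eta> * X k))"
      using Chernoff_pmf_ge[OF fin \<eta>, where X = X and t = "\<delta> + t"] by (simp add: algebra_simps)
    also have "\<dots> \<le> exp (- \<eta> * (\<delta> + t)) * exp (\<delta> * (exp (2 * \<eta>) - 1) / 2)"
      by (intro mult_left_mono mgf) simp
    also have "\<dots> = exp (- (\<delta> * ((1 + t / \<delta>) * ln (1 + t / \<delta>) - t / \<delta>)) / 2)"
      unfolding exp_add[symmetric] \<eta>_def using r by (subst exponent_eq_psi[OF 3]) auto
    finally show ?thesis using 3 t by (subst exp_ereal_scaled_psi) (auto simp: order_trans[of "-1" 0])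
  qed
qed

lemma scaled_psi_lower_tail:
  assumes t: "t \<ge> 0"
  shows "ereal (measure_pmf.prob p {k. X k - \<delta> \<le> - t}) \<le> exp_ereal (- (1 / 2) * scaled_psi \<delta> (- t))"
proof -
  have le: "measure_pmf.prob p {k. X k - \<delta> \<le> - t} \<le> exp (\<eta> * (\<delta> - t) + \<delta> * (exp (- 2 * \<eta>) - 1) / 2)"
    if \<eta>: "\<eta> \<ge> 0" for \<eta>
  proof -
    have "measure_pmf.prob p {k. X k - \<delta> \<le> - t} = measure_pmf.prob p {k. - X k \<ge> t - \<delta>}"
      by (rule arg_cong[where f = "measure_pmf.prob p"]) auto
    also have "\<dots> \<le> exp (- \<eta> * (t - \<delta>)) * measure_pmf.expectation p (\<lambda>k. exp (\<eta> * (- X k)))"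
      by (rule Chernoff_pmf_ge[OF fin \<eta>])
    also have "\<dots> \<le> exp (- \<eta> * (t - \<delta>)) * exp (\<delta> * (exp (2 * (- \<eta>)) - 1) / 2)"
      using mgf[of "- \<eta>"] by (intro mult_left_mono) auto
    finally show ?thesis by (simp add: algebra_simps flip: exp_add)
  qed
  consider "\<delta> = 0" "t = 0" | "\<delta> < t" | "\<delta> > 0" "t < \<delta>" | "\<delta> > 0" "t = \<delta>" using mean_nonneg t by linarith
  then show ?thesis
  proof cases
    case 1
    then show ?thesis by (simp add: scaled_psi_def psi_def exp_ereal_def zero_ereal_def)
  next
    \<comment> \<open>The event would force \<open>X\<close> to be negative, and the bound is 0: the
      argument of \<open>psi\<close> is below -1, or \<delta> = 0 and the convention in
      \<open>scaled_psi\<close> applies.\<close>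
    case 2
    have "{k. X k - \<delta> \<le> - t} = {k. X k \<le> \<delta> - t}" by auto
    then have "measure_pmf.prob p {k. X k - \<delta> \<le> - t} = 0"
      using prob_nonneg_lower_eq_0[of "\<delta> - t"] 2 by simp
    moreover have "scaled_psi \<delta> (- t) = \<infinity>"
      using 2 mean_nonneg by (auto simp: scaled_psi_def psi_def field_simps)
    ultimately show ?thesis by (simp only: exp_ereal_infinity) simp
  next
    case 3
    have r: "1 + (- t) / \<delta> > 0" "1 + (- t) / \<delta> \<le> 1" using 3 t by (auto simp: field_simps)
    \<comment> \<open>The optimal parameter with its sign reversed, since Chernoff's bound is
      applied to the negative of \<open>X\<close>.\<close>
    define \<eta> where "\<eta> = - (ln (1 + (- t) / \<delta>) / 2)"
    have \<eta>: "\<eta> \<ge> 0" using r by (simp add: \<eta>_def)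
    have "\<eta> * (\<delta> - t) + \<delta> * (exp (- 2 * \<eta>) - 1) / 2 =
        - (\<delta> * ((1 + (- t) / \<delta>) * ln (1 + (- t) / \<delta>) - (- t) / \<delta>)) / 2"
      using exponent_eq_psi[OF 3(1) r(1)] by (simp add: \<eta>_def)
    then have "measure_pmf.prob p {k. X k - \<delta> \<le> - t} \<le>
       exp (- (\<delta> * ((1 + (- t) / \<delta>) * ln (1 + (- t) / \<delta>) - (- t) / \<delta>)) / 2)"
      using le[OF \<eta>] by simp
    then show ?thesis using 3 r by (subst exp_ereal_scaled_psi) auto
  next
    \<comment> \<open>At the endpoint the optimal \<eta> would be infinite. The bound is the limit
      as \<eta> grows, and it agrees with \<open>psi (- 1) = 1\<close>.\<close>
    case 4
    have "((\<lambda>\<eta>. exp (\<eta> * (\<delta> - t) + \<delta> * (exp (- 2 * \<eta>) - 1) / 2)) \<longlongrightarrow> exp (- \<delta> / 2)) at_top"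
      using 4 by real_asymp
    then have "measure_pmf.prob p {k. X k - \<delta> \<le> - t} \<le> exp (- \<delta> / 2)"
    proof (rule tendsto_lowerbound)
      show "\<forall>\<^sub>F \<eta> in at_top. measure_pmf.prob p {k. X k - \<delta> \<le> - t} \<le>
          exp (\<eta> * (\<delta> - t) + \<delta> * (exp (- 2 * \<eta>) - 1) / 2)"
        using eventually_ge_at_top[of 0] by eventually_elim (rule le)
    qed simp
    then show ?thesis using 4 by (subst exp_ereal_scaled_psi) auto
  qed
qed

end

lemma le_exp_ereal_half_max:
  assumes "x \<le> exp_ereal (- (1 / 2) * a)" "x \<le> exp_ereal (- (1 / 2) * b)"
  shows "x \<le> exp_ereal (- (1 / 2) * max a b)"
  using assms by (cases "a \<le> b") (auto simp: max_def)

section \<open>The law of the intrinsic volume variable and its behaviour under polarity\<close>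

lemma sum_conic_intrinsic_volume:
  fixes C :: "'a::euclidean_space set"
  assumes C: "closed_convex_cone C"
  shows "(\<Sum>k\<le>DIM('a). conic_intrinsic_volume C k) = 1"
proof -
  have "ennreal (\<Sum>k\<le>DIM('a). conic_intrinsic_volume C k) = 1"
    using conic_Steiner[OF C, of 1] cone_gauss_one[OF C] by simp
  then show ?thesis
    by (subst (asm) ennreal_eq_1) auto
qed

lemma pmf_intrinsic_volume_pmf:
  fixes C :: "'a::euclidean_space set"
  assumes C: "closed_convex_cone C"
  shows "pmf (intrinsic_volume_pmf C) k = (if k \<le> DIM('a) then conic_intrinsic_volume C k else 0)"
  unfolding intrinsic_volume_pmf_def
proof (rule pmf_embed_pmf)
  let ?f = "\<lambda>k. if k \<le> DIM('a) then conic_intrinsic_volume C k else 0"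
  show nn: "0 \<le> ?f k" for k using conic_intrinsic_volume_nonneg[OF C] by simp
  have "(\<integral>\<^sup>+k. ennreal (?f k) \<partial>count_space UNIV) = (\<Sum>k\<le>DIM('a). ennreal (?f k))"
    by (rule nn_integral_count_space') auto
  also have "\<dots> = ennreal (\<Sum>k\<le>DIM('a). ?f k)" using nn by (intro sum_ennreal) blast
  also have "\<dots> = 1" using sum_conic_intrinsic_volume[OF C] by simp
  finally show "(\<integral>\<^sup>+k. ennreal (?f k) \<partial>count_space UNIV) = 1" .
qed

lemma set_intrinsic_volume_pmf:
  fixes C :: "'a::euclidean_space set"
  assumes C: "closed_convex_cone C"
  shows "set_pmf (intrinsic_volume_pmf C) \<subseteq> {..DIM('a)}"
  by (auto simp: set_pmf_eq pmf_intrinsic_volume_pmf[OF C] split: if_splits)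

lemma expectation_intrinsic_volume_pmf:
  fixes C :: "'a::euclidean_space set" and f :: "nat \<Rightarrow> real"
  assumes C: "closed_convex_cone C"
  shows "measure_pmf.expectation (intrinsic_volume_pmf C) f =
    (\<Sum>k\<le>DIM('a). conic_intrinsic_volume C k * f k)"
  using set_intrinsic_volume_pmf[OF C]
  by (subst integral_measure_pmf[of "{..DIM('a)}"]) (auto simp: pmf_intrinsic_volume_pmf[OF C])

text \<open>Through the Steiner formula at sqrt s, the midpoint inequality for the Gaussian integral
  is the hypothesis of the tangent estimate; the weighted coefficient sum in that estimate is the
  statistical dimension.\<close>

lemma conic_intrinsic_volume_mgf_bound:
  fixes C :: "'a::euclidean_space set"
  assumes C: "closed_convex_cone C" and z: "z > 0"
  shows "(\<Sum>k\<le>DIM('a). conic_intrinsic_volume C k * z ^ k) \<le>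
    exp (statistical_dimension C * (z\<^sup>2 - 1) / 2)"
proof -
  let ?p = "\<lambda>z. \<Sum>k\<le>DIM('a). conic_intrinsic_volume C k * z ^ k"
  have "?p (sqrt s) \<le> (?p (sqrt ((1 + s) / 2)))\<^sup>2" if s: "s > 0" for s
  proof -
    have nn: "0 \<le> ?p z" if "z > 0" for z
      using conic_intrinsic_volume_nonneg[OF C] that by (intro sum_nonneg mult_nonneg_nonneg) auto
    have "ennreal (?p (sqrt s)) \<le> (ennreal (?p (sqrt ((1 + s) / 2))))\<^sup>2"
      using cone_gauss_midpoint[OF C s] conic_Steiner[OF C, of "sqrt s"]
        conic_Steiner[OF C, of "sqrt ((1 + s) / 2)"] s by simp
    then show ?thesis using s nn[of "sqrt ((1 + s) / 2)"]
      by (simp add: ennreal_power ennreal_le_iff)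
  qed
  from polynomial_le_exp_of_midpoint[OF conic_intrinsic_volume_nonneg[OF C]
      sum_conic_intrinsic_volume[OF C] this z]
  show ?thesis
    by (simp add: statistical_dimension_def expectation_intrinsic_volume_pmf[OF C] mult.commute)
qed

text \<open>Multiplying a polynomial in 1 / z by \<open>z ^ DIM('a)\<close> reverses its
  coefficients. Working with generating functions avoids matching the faces of a cone with those of
  its polar and covers all closed convex cones at once.\<close>

lemma conic_intrinsic_volume_polar:
  fixes C :: "'a::euclidean_space set"
  assumes C: "closed_convex_cone C" and k: "k \<le> DIM('a)"
  shows "conic_intrinsic_volume (polar_cone C) k = conic_intrinsic_volume C (DIM('a) - k)"
proof (rule polynomial_coeffs_eq[OF _ k, of "conic_intrinsic_volume (polar_cone C)"
      "\<lambda>k. conic_intrinsic_volume C (DIM('a) - k)"])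
  fix z :: real assume z: "z > 0"
  let ?v = "conic_intrinsic_volume C" and ?w = "conic_intrinsic_volume (polar_cone C)"
  note nn = conic_intrinsic_volume_nonneg[OF C] conic_intrinsic_volume_nonneg[OF closed_convex_cone_polar[of C]]
  have "ennreal (\<Sum>k\<le>DIM('a). ?w k * z ^ k) = ennreal (z ^ DIM('a)) * cone_gauss C ((1 / z)\<^sup>2)"
    using conic_Steiner[OF closed_convex_cone_polar z, of C] cone_gauss_polar[OF C z]
    by (simp add: power_divide)
  also have "\<dots> = ennreal (z ^ DIM('a) * (\<Sum>k\<le>DIM('a). ?v k * (1 / z) ^ k))"
  proof -
    have "0 \<le> (\<Sum>k\<le>DIM('a). ?v k * (1 / z) ^ k)"
      using nn z by (intro sum_nonneg mult_nonneg_nonneg) auto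
    then show ?thesis using conic_Steiner[OF C, of "1 / z"] z by (simp add: ennreal_mult)
  qed
  finally have "(\<Sum>k\<le>DIM('a). ?w k * z ^ k) = z ^ DIM('a) * (\<Sum>k\<le>DIM('a). ?v k * (1 / z) ^ k)"
    using nn z by (subst (asm) ennreal_inj) (auto intro!: sum_nonneg mult_nonneg_nonneg)
  also have "\<dots> = (\<Sum>k\<le>DIM('a). ?v k * z ^ (DIM('a) - k))"
    using z by (simp add: sum_distrib_left power_diff power_divide field_simps)
  also have "\<dots> = (\<Sum>k\<le>DIM('a). ?v (DIM('a) - k) * z ^ k)"
    by (rule sum.reindex_bij_witness[of _ "\<lambda>k. DIM('a) - k" "\<lambda>k. DIM('a) - k"]) auto
  finally show "(\<Sum>k\<le>DIM('a). ?w k * z ^ k) = (\<Sum>k\<le>DIM('a). ?v (DIM('a) - k) * z ^ k)" .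
qed

lemma intrinsic_volume_pmf_polar:
  fixes C :: "'a::euclidean_space set"
  assumes C: "closed_convex_cone C"
  shows "measure_pmf.expectation (intrinsic_volume_pmf (polar_cone C)) f =
    measure_pmf.expectation (intrinsic_volume_pmf C) (\<lambda>k. f (DIM('a) - k) :: real)"
  unfolding expectation_intrinsic_volume_pmf[OF C] expectation_intrinsic_volume_pmf[OF closed_convex_cone_polar]
  by (rule sum.reindex_bij_witness[of _ "\<lambda>k. DIM('a) - k" "\<lambda>k. DIM('a) - k"])
     (auto simp: conic_intrinsic_volume_polar[OF C])

lemma intrinsic_volume_pmf_mgf:
  fixes C :: "'a::euclidean_space set"
  assumes C: "closed_convex_cone C"
  shows "measure_pmf.expectation (intrinsic_volume_pmf C) (\<lambda>k. exp (\<eta> * real k)) \<le>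
    exp (statistical_dimension C * (exp (2 * \<eta>) - 1) / 2)"
  using conic_intrinsic_volume_mgf_bound[OF C, of "exp \<eta>"]
  by (simp add: expectation_intrinsic_volume_pmf[OF C] exp_of_nat_mult[symmetric] exp_double mult.commute)

theorem corollary4p10:
  fixes C :: "(real ^ 'n) set" and lam :: real
  assumes "closed_convex_cone C"
    and "lam \<ge> 0"
  shows "ereal (measure_pmf.prob (intrinsic_volume_pmf C)
            {k. real k - statistical_dimension C \<ge> lam})
        \<le> exp_ereal (- (1 / 2) *
            max (scaled_psi (statistical_dimension C) lam)
                (scaled_psi (statistical_dimension (polar_cone C)) (- lam)))
      \<and> ereal (measure_pmf.prob (intrinsic_volume_pmf C)
            {k. real k - statistical_dimension C \<le> - lam})
        \<le> exp_ereal (- (1 / 2) *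
            max (scaled_psi (statistical_dimension C) (- lam))
                (scaled_psi (statistical_dimension (polar_cone C)) lam))"
proof -
  let ?p = "intrinsic_volume_pmf C" and ?d = "DIM(real ^ 'n)"
  let ?\<delta> = "statistical_dimension C" and ?\<delta>' = "statistical_dimension (polar_cone C)"
  let ?Y = "\<lambda>k. real (?d - k)"
  note C = assms(1)
  have fin: "finite (set_pmf ?p)" using set_intrinsic_volume_pmf[OF C] finite_subset by blast
  have mean: "measure_pmf.expectation ?p real = ?\<delta>" by (simp add: statistical_dimension_def)
  \<comment> \<open>Under the law of V, the variable d - V has the law belonging to the polar cone,
    so no second probability space is needed.\<close>
  have mean': "measure_pmf.expectation ?p ?Y = ?\<delta>'"
    by (simp add: statistical_dimension_def intrinsic_volume_pmf_polar[OF C])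
  note mgf = intrinsic_volume_pmf_mgf[OF C]
  have mgf': "measure_pmf.expectation ?p (\<lambda>k. exp (\<eta> * ?Y k)) \<le> exp (?\<delta>' * (exp (2 * \<eta>) - 1) / 2)" for \<eta>
    using intrinsic_volume_pmf_mgf[OF closed_convex_cone_polar[of C], of \<eta>]
    unfolding intrinsic_volume_pmf_polar[OF C] .
  \<comment> \<open>The subtraction in \<open>?Y\<close> is truncated, but the support lies in
    \<open>{..?d}\<close>, where it is exact.\<close>
  have Y: "?Y k = real ?d - real k" if "k \<in> set_pmf ?p" for k
    using set_intrinsic_volume_pmf[OF C] that by (auto simp: of_nat_diff)
  note Y = Y Y[simplified]
  have dual: "?\<delta>' = real ?d - ?\<delta>"
  proof -
    have "?\<delta>' = measure_pmf.expectation ?p (\<lambda>k. real ?d - real k)"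
      unfolding mean'[symmetric] by (rule integral_cong_AE) (auto simp: AE_measure_pmf_iff Y)
    also have "\<dots> = real ?d - ?\<delta>"
      unfolding mean[symmetric] by (simp add: integrable_measure_pmf_finite[OF fin])
    finally show ?thesis .
  qed
  \<comment> \<open>The centred variables are negatives of each other, so upper and lower tails
    trade places. The events agree only almost surely, because of the truncated subtraction outside
    the support.\<close>
  have up: "measure_pmf.prob ?p {k. real k - ?\<delta> \<ge> lam} = measure_pmf.prob ?p {k. ?Y k - ?\<delta>' \<le> - lam}"
    and low: "measure_pmf.prob ?p {k. real k - ?\<delta> \<le> - lam} = measure_pmf.prob ?p {k. ?Y k - ?\<delta>' \<ge> lam}"
    by (auto intro!: measure_pmf.finite_measure_eq_AE simp: AE_measure_pmf_iff Y dual)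
  show ?thesis
  proof (intro conjI le_exp_ereal_half_max)
    note X_args = fin _ mean mgf assms(2) and Y_args = fin _ mean' mgf' assms(2)
    show "ereal (measure_pmf.prob ?p {k. real k - ?\<delta> \<ge> lam}) \<le> exp_ereal (- (1 / 2) * scaled_psi ?\<delta> lam)"
      by (rule scaled_psi_upper_tail[OF X_args]) simp
    show "ereal (measure_pmf.prob ?p {k. real k - ?\<delta> \<le> - lam}) \<le> exp_ereal (- (1 / 2) * scaled_psi ?\<delta> (- lam))"
      by (rule scaled_psi_lower_tail[OF X_args]) simp
    show "ereal (measure_pmf.prob ?p {k. real k - ?\<delta> \<ge> lam}) \<le> exp_ereal (- (1 / 2) * scaled_psi ?\<delta>' (- lam))"
      unfolding up by (rule scaled_psi_lower_tail[OF Y_args]) simp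
    show "ereal (measure_pmf.prob ?p {k. real k - ?\<delta> \<le> - lam}) \<le> exp_ereal (- (1 / 2) * scaled_psi ?\<delta>' lam)"
      unfolding low by (rule scaled_psi_upper_tail[OF Y_args]) simp
  qed
qed

end
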